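(* Let $N\ge 1$, $M\ge 1$, $1\le Q\le N$ be integers. Consider the channel $$\mathbf{Y}=\mathbf{S}\,\mathbf{P}^{T}\,\mathrm{diag}\{\mathbf{x}\}+\mathbf{W},$$ where $\mathbf{x}\in\mathbb{C}^{N}$ is the input; $\mathbf{S}\in\mathbb{C}^{M\times Q}$ has i.i.d. $\mathcal{CN}(0,1)$ entries; $\mathbf{P}\in\mathbb{C}^{N\times Q}$ is deterministic, of full rank $Q$, and each of its rows has unit Euclidean norm; $\mathbf{W}\in\mathbb{C}^{M\times N}$ has i.i.d. $\mathcal{CN}(0,1)$ entries; and $\mathbf{x}$, $\mathbf{S}$, $\mathbf{W}$ are mutually independent. For $\rho>0$ let $$C(\rho)=\frac{1}{N}\sup I(\mathbf{x};\mathbf{Y}),$$ the supremum being over all distributions of $\mathbf{x}$ satisfying $\mathbb{E}[\|\mathbf{x}\|^{2}]\le N\rho$. Then $$\limsup_{\rho\to\infty}\frac{C(\rho)}{\log\rho}\;\le\;\min\Big\{M\Big(1-\frac{Q}{N}\Big),\;1-\frac{1}{N}\Big\}.$$ *)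

theory Defs
  imports "HOL-Probability.Probability"
begin

definition cnormal :: "complex measure" where
  "cnormal = distr (density lborel (normal_density 0 (sqrt (1/2))) \<Otimes>\<^sub>M
                    density lborel (normal_density 0 (sqrt (1/2))))
                   borel (\<lambda>(a, b). Complex a b)"

definition iid_cnormal_matrix :: "(complex ^ 'q ^ 'm) measure" where
  "iid_cnormal_matrix =
     distr (PiM UNIV (\<lambda>_ :: 'm \<times> 'q. cnormal)) borel (\<lambda>f. \<chi> i j. f (i, j))"

definition diag_vec :: "complex ^ 'n \<Rightarrow> complex ^ 'n ^ 'n" where
  "diag_vec x = (\<chi> i j. if i = j then x $ i else 0)"

definition channel_out ::
  "complex ^ 'q ^ 'n \<Rightarrow> complex ^ 'n \<Rightarrow> complex ^ 'q ^ 'm \<Rightarrow> complex ^ 'n ^ 'm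
   \<Rightarrow> complex ^ 'n ^ 'm" where
  "channel_out P x S W = S ** transpose P ** diag_vec x + W"

definition joint_law ::
  "(complex ^ 'n) measure \<Rightarrow> ((complex ^ 'n) \<times> ((complex ^ 'q ^ 'm) \<times> (complex ^ 'n ^ 'm))) measure" where
  "joint_law mu = mu \<Otimes>\<^sub>M (iid_cnormal_matrix \<Otimes>\<^sub>M iid_cnormal_matrix)"

definition mi_xY ::
  "complex ^ 'q ^ 'n \<Rightarrow> (complex ^ 'n) measure \<Rightarrow> 'm::finite itself \<Rightarrow> real" where
  "mi_xY P mu _ =
     prob_space.mutual_information
       (joint_law mu :: ((complex ^ 'n) \<times> ((complex ^ 'q ^ 'm) \<times> (complex ^ 'n ^ 'm))) measure)
       (exp 1) borel borel fst (\<lambda>(x, S, W). channel_out P x S W)"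

definition admissible_input :: "real \<Rightarrow> (complex ^ 'n) measure \<Rightarrow> bool" where
  "admissible_input rho mu \<longleftrightarrow>
     prob_space mu \<and> sets mu = sets borel \<and>
     (\<integral>\<^sup>+ x. ennreal ((norm x)\<^sup>2) \<partial>mu) \<le> ennreal (real CARD('n) * rho)"

definition capacity ::
  "complex ^ 'q ^ 'n \<Rightarrow> 'm::finite itself \<Rightarrow> real \<Rightarrow> ereal" where
  "capacity P m rho =
     (SUP mu \<in> {mu :: (complex ^ 'n) measure. admissible_input rho mu}.
        ereal (mi_xY P mu m)) / ereal (real CARD('n))"

end

theory Submission
  imports Defs "HOL-Real_Asymp.Real_Asymp"
begin

text \<open>
  Let \<open>p x Y\<close> be the conditional density of the output. If a single integrable function \<open>q\<close>
  satisfies \<open>p x Y \<le> (1 + \<bar>x\<bar>\<^sup>2) powr B * q Y\<close> for all \<open>x\<close> and \<open>Y\<close>, then comparing the output law with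
  the normalization of \<open>q\<close> bounds the mutual information by \<open>ln (\<integral>q) + B * E[ln (1 + \<bar>x\<bar>\<^sup>2)]\<close>, so the
  pre-log is at most \<open>B / N\<close>. Two choices of \<open>q\<close> give the two bounds.

  For \<open>B = M (N - Q) + \<epsilon>\<close>, take for \<open>q\<close> the product over the entries of \<open>Y\<close> of the heavy tails
  \<open>(1 + \<bar>Y m n\<bar>\<^sup>2) powr -(1 + \<epsilon>)\<close>. This costs a factor \<open>(1 + \<bar>x n\<bar>\<^sup>2) powr (1 + \<epsilon>)\<close> per entry, while at
  \<open>Q\<close> indices whose rows of \<open>P\<close> are linearly independent the Gaussian integral over \<open>S\<close> gains
  \<open>1 / (1 + \<bar>x n\<bar>\<^sup>2)\<close>.

  For \<open>B = N - 1 + \<epsilon>\<close>, take for \<open>q\<close> the mixture over \<open>x'\<close>, with weight \<open>(1 + \<bar>x'\<bar>\<^sup>2) powr -(N + \<epsilon>)\<close>, of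
  slightly flattened output densities. Up to constants, \<open>p x\<close> is dominated by the component at \<open>x'\<close>
  as soon as \<open>x'\<close> has distance at most 1 from \<open>c x\<close> for some complex \<open>c\<close> with \<open>1 \<le> \<bar>c\<bar> \<le> 3\<close>, and the
  set of such \<open>x'\<close> has volume of order \<open>1 + \<bar>x\<bar>\<^sup>2\<close>.

  Keeping \<open>p x\<close> in the form of an integral over \<open>S\<close> avoids determinants of covariance matrices.
\<close>

section \<open>Lebesgue measure\<close>

lemma nn_integral_lborel_translate:
  fixes t :: "'a::euclidean_space"
  assumes [measurable]: "f \<in> borel_measurable borel"
  shows "(\<integral>\<^sup>+x. f (t + x) \<partial>lborel) = (\<integral>\<^sup>+x. f x \<partial>lborel)"
proof -
  have "(\<integral>\<^sup>+x. f x \<partial>lborel) = (\<integral>\<^sup>+x. f x \<partial>distr lborel borel ((+) t))"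
    by (simp only: lborel_distr_plus)
  also have "\<dots> = (\<integral>\<^sup>+x. f (t + x) \<partial>lborel)"
    by (rule nn_integral_distr) auto
  finally show ?thesis ..
qed

lemma nn_integral_lborel_scaleR:
  fixes f :: "'a::euclidean_space \<Rightarrow> ennreal"
  assumes [measurable]: "f \<in> borel_measurable borel" and "c \<noteq> 0"
  shows "(\<integral>\<^sup>+x. f x \<partial>lborel) = ennreal (\<bar>c\<bar> ^ DIM('a)) * (\<integral>\<^sup>+x. f (c *\<^sub>R x) \<partial>lborel)"
  by (subst lborel_affine[OF \<open>c \<noteq> 0\<close>, of 0])
     (simp add: nn_integral_density nn_integral_distr nn_integral_cmult)

text \<open>
  The image of Lebesgue measure under \<open>L\<close> is translation invariant; applying Fubini to
  \<open>f (L s + t) * g t\<close>, with \<open>g\<close> the indicator of the unit ball, identifies it up to the factor.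
\<close>

lemma nn_integral_lborel_linear:
  fixes L :: "'a::euclidean_space \<Rightarrow> 'a"
  assumes L: "linear L" "surj L" and f[measurable]: "f \<in> borel_measurable borel"
  shows "(\<integral>\<^sup>+s. f (L s) \<partial>lborel) * emeasure lborel (ball (0::'a) 1)
    = emeasure lborel {s. norm (L s) < 1} * (\<integral>\<^sup>+t. f t \<partial>lborel)"
proof -
  have [measurable]: "L \<in> borel_measurable borel"
    using L by (intro borel_measurable_continuous_onI linear_continuous_on)
      (simp add: linear_conv_bounded_linear)
  define g :: "'a \<Rightarrow> ennreal" where "g = indicator (ball 0 1)"
  have [measurable]: "g \<in> borel_measurable borel" unfolding g_def by (intro borel_measurable_indicator) auto
  have shift: "(\<integral>\<^sup>+s. h (L s + t) \<partial>lborel) = (\<integral>\<^sup>+s. h (L s) \<partial>lborel)"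
    if [measurable]: "h \<in> borel_measurable borel" for h :: "'a \<Rightarrow> ennreal" and t
  proof -
    \<comment> \<open>Surjectivity puts the shift inside \<open>L\<close>, where it becomes a
      translation of \<open>s\<close>.\<close>
    obtain a where "t = L a" using L(2) by blast
    then have "h (L s + t) = h (L (a + s))" for s
      using L(1) by (simp add: linear_add add.commute)
    then show ?thesis using nn_integral_lborel_translate[of "\<lambda>s. h (L s)" a] by simp
  qed
  have "(\<integral>\<^sup>+s. f (L s) \<partial>lborel) * (\<integral>\<^sup>+t. g t \<partial>lborel)
      = (\<integral>\<^sup>+t. (\<integral>\<^sup>+s. f (L s) \<partial>lborel) * g t \<partial>lborel)"
    by (simp add: nn_integral_cmult)
  also have "\<dots> = (\<integral>\<^sup>+t. (\<integral>\<^sup>+s. f (L s + t) * g t \<partial>lborel) \<partial>lborel)"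
    by (simp add: shift[OF f] nn_integral_multc)
  also have "\<dots> = (\<integral>\<^sup>+s. (\<integral>\<^sup>+t. f (L s + t) * g t \<partial>lborel) \<partial>lborel)"
    by (rule lborel_pair.Fubini') measurable
  also have "\<dots> = (\<integral>\<^sup>+s. (\<integral>\<^sup>+t. f t * g (t - L s) \<partial>lborel) \<partial>lborel)"
  proof (rule nn_integral_cong)
    fix s
    show "(\<integral>\<^sup>+t. f (L s + t) * g t \<partial>lborel) = (\<integral>\<^sup>+t. f t * g (t - L s) \<partial>lborel)"
      using nn_integral_lborel_translate[of "\<lambda>t. f t * g (t - L s)" "L s"] by simp
  qed
  \<comment> \<open>The ball is symmetric, so the argument of \<open>g\<close> may change sign; the
    inner integral is then removed from its dependence on \<open>t\<close> by \<open>shift\<close>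
    with \<open>- t\<close>.\<close>
  also have "\<dots> = (\<integral>\<^sup>+t. (\<integral>\<^sup>+s. f t * g (L s - t) \<partial>lborel) \<partial>lborel)"
    by (subst lborel_pair.Fubini') (auto simp: g_def dist_norm norm_minus_commute indicator_def)
  also have "\<dots> = (\<integral>\<^sup>+t. f t * (\<integral>\<^sup>+s. g (L s) \<partial>lborel) \<partial>lborel)"
    using shift[of g "- _"] by (simp add: nn_integral_cmult)
  also have "(\<integral>\<^sup>+s. g (L s) \<partial>lborel) = emeasure lborel {s. norm (L s) < 1}"
  proof -
    have "g (L s) = indicator {s. norm (L s) < 1} s" for s
      by (simp add: g_def indicator_def)
    then show ?thesis by simp
  qed
  finally show ?thesis by (simp add: nn_integral_multc mult.commute g_def)
qed

section \<open>Lebesgue measure on complex numbers and matrices in coordinates\<close>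

lemma prod_Basis_vec:
  "(\<Prod>b\<in>(Basis :: ('a::euclidean_space^'n) set). F b) = (\<Prod>i\<in>UNIV. \<Prod>u\<in>Basis. F (axis i u))"
proof -
  have "(\<Prod>b\<in>(Basis :: ('a^'n) set). F b) = (\<Prod>b\<in>(\<Union>i\<in>UNIV. (\<lambda>u. axis i u) ` Basis). F b)"
    unfolding Basis_vec_def by (intro prod.cong) auto
  also have "\<dots> = (\<Prod>i\<in>UNIV. \<Prod>b\<in>(\<lambda>u. axis i u) ` Basis. F b)"
    by (rule prod.UNION_disjoint) (auto simp: axis_eq_axis)
  also have "\<dots> = (\<Prod>i\<in>UNIV. \<Prod>u\<in>Basis. F (axis i u))"
    by (intro prod.cong refl prod.reindex_cong[of "axis _"]) (auto simp: inj_on_def axis_eq_axis)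
  finally show ?thesis .
qed

lemma borel_measurable_matrix:
  fixes f :: "'b \<Rightarrow> 'a::euclidean_space^'n^'m"
  assumes "\<And>i j. (\<lambda>x. f x $ i $ j) \<in> borel_measurable M"
  shows "f \<in> borel_measurable M"
  unfolding borel_measurable_euclidean_space[of f]
  using assms by (auto simp: Basis_vec_def inner_axis)

text \<open>Both measures give a box the product of its side lengths, and Lebesgue measure is
  determined by that. The form on the right matches \<open>cnormal\<close>, so the two real normal
  densities can be pushed to the complex plane.\<close>

lemma lborel_complex: "(lborel :: complex measure) = distr (lborel \<Otimes>\<^sub>M lborel) borel (\<lambda>(a, b). Complex a b)"
proof (rule lborel_eqI)
  fix l u :: complex
  assume lu: "\<And>b. b \<in> Basis \<Longrightarrow> l \<bullet> b \<le> u \<bullet> b"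
  have [measurable]: "(\<lambda>(a, b). Complex a b) \<in> borel_measurable (lborel \<Otimes>\<^sub>M lborel)"
    by (auto simp: borel_measurable_complex_iff split_beta)
  have "emeasure (distr (lborel \<Otimes>\<^sub>M lborel) borel (\<lambda>(a, b). Complex a b)) (box l u)
      = emeasure (lborel \<Otimes>\<^sub>M lborel) ({Re l<..<Re u} \<times> {Im l<..<Im u})"
    by (subst emeasure_distr) (auto simp: box_def Basis_complex_def space_pair_measure intro!: arg_cong2[where f=emeasure])
  also have "\<dots> = ennreal (\<Prod>b\<in>Basis. (u - l) \<bullet> b)"
    using lu[of 1] lu[of \<i>] by (subst lborel.emeasure_pair_measure_Times)
      (auto simp: Basis_complex_def ennreal_mult)
  finally show "emeasure (distr (lborel \<Otimes>\<^sub>M lborel) borel (\<lambda>(a, b). Complex a b)) (box l u)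
    = ennreal (\<Prod>b\<in>Basis. (u - l) \<bullet> b)" .
qed simp

text \<open>A box of matrices is a product of boxes for the entries, so the volumes agree. The form
  on the right matches \<open>iid_cnormal_matrix\<close>.\<close>

lemma lborel_matrix:
  "(lborel :: ('a::euclidean_space^'n^'m) measure)
    = distr (PiM UNIV (\<lambda>_ :: 'm \<times> 'n. lborel)) borel (\<lambda>f. \<chi> i j. f (i, j))"
proof (rule lborel_eqI)
  interpret product_sigma_finite "\<lambda>_ :: 'm \<times> 'n. lborel :: 'a measure" ..
  let ?v = "\<lambda>f. (\<chi> i j. f (i, j)) :: 'a^'n^'m"
  fix l u :: "'a^'n^'m"
  assume lu: "\<And>b. b \<in> Basis \<Longrightarrow> l \<bullet> b \<le> u \<bullet> b"
  have lu': "l $ i $ j \<bullet> b \<le> u $ i $ j \<bullet> b" if "b \<in> Basis" for i j b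
    using lu[of "axis i (axis j b)"] that by (simp add: inner_axis axis_in_Basis_iff)
  have [measurable]: "?v \<in> borel_measurable (PiM UNIV (\<lambda>_. lborel))"
    by (rule borel_measurable_matrix) simp
  have "x \<in> box l u \<longleftrightarrow> (\<forall>i j. x $ i $ j \<in> box (l $ i $ j) (u $ i $ j))" for x
    by (auto simp: mem_box Basis_vec_def inner_axis)
  then have "?v -` box l u \<inter> space (PiM UNIV (\<lambda>_. lborel)) = PiE UNIV (\<lambda>(i, j). box (l $ i $ j) (u $ i $ j))"
    by (simp add: space_PiM PiE_def Pi_def set_eq_iff split_beta)
  then have "emeasure (distr (PiM UNIV (\<lambda>_. lborel)) borel ?v) (box l u)
    = emeasure (PiM UNIV (\<lambda>_. lborel)) (PiE UNIV (\<lambda>(i, j). box (l $ i $ j) (u $ i $ j)))"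
    by (subst emeasure_distr) simp_all
  also have "\<dots> = (\<Prod>(i, j)\<in>UNIV. emeasure lborel (box (l $ i $ j) (u $ i $ j)))"
    by (subst emeasure_PiM) (auto simp: split_beta)
  also have "\<dots> = (\<Prod>i\<in>UNIV. \<Prod>j\<in>UNIV. ennreal (\<Prod>b\<in>Basis. (u $ i $ j - l $ i $ j) \<bullet> b))"
    using lu' by (simp add: prod.cartesian_product)
  also have "\<dots> = ennreal (\<Prod>b\<in>Basis. (u - l) \<bullet> b)"
    using lu' by (simp add: prod_Basis_vec inner_axis prod_ennreal prod_nonneg inner_diff_left)
  finally show "emeasure (distr (PiM UNIV (\<lambda>_. lborel)) borel ?v) (box l u)
    = ennreal (\<Prod>b\<in>Basis. (u - l) \<bullet> b)" .
qed simp

text \<open>Tonelli in the matrix entries. It serves twice: to integrate the product of heavy tails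
  over \<open>Y\<close>, and to split the Gaussian integral over the transformed fading
  matrix.\<close>

lemma nn_integral_lborel_matrix:
  fixes f :: "'m::finite \<Rightarrow> 'n::finite \<Rightarrow> 'a::euclidean_space \<Rightarrow> ennreal"
  assumes [measurable]: "\<And>i j. f i j \<in> borel_measurable borel"
  shows "(\<integral>\<^sup>+Y. (\<Prod>i\<in>UNIV. \<Prod>j\<in>UNIV. f i j (Y $ i $ j)) \<partial>lborel)
    = (\<Prod>i\<in>UNIV. \<Prod>j\<in>UNIV. \<integral>\<^sup>+z. f i j z \<partial>lborel)"
proof -
  interpret product_sigma_finite "\<lambda>_ :: 'm \<times> 'n. lborel :: 'a measure" ..
  have [measurable]: "(\<lambda>f. (\<chi> i j. f (i, j)) :: 'a^'n^'m) \<in> borel_measurable (PiM UNIV (\<lambda>_. lborel))"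
    by (rule borel_measurable_matrix) simp
  have [measurable]: "(\<lambda>Y::'a^'n^'m. Y $ i $ j) \<in> borel_measurable borel" for i j
    by (intro borel_measurable_continuous_onI continuous_intros)
  show ?thesis
    using product_nn_integral_prod[of UNIV "\<lambda>(i, j). f i j"]
    by (subst lborel_matrix)
      (simp add: nn_integral_distr prod.cartesian_product split_beta)
qed

section \<open>Density of the noise and of the fading\<close>

text \<open>Variance 1/2 in the real and in the imaginary part makes the exponents add up to minus
  the squared modulus, with constant 1/pi.\<close>

lemma cnormal_eq_density: "cnormal = density lborel (\<lambda>z. ennreal (exp (- (norm z)\<^sup>2) / pi))"
proof -
  have [measurable]: "(\<lambda>(a, b). Complex a b) \<in> borel_measurable (lborel \<Otimes>\<^sub>M lborel)"
    by (auto simp: borel_measurable_complex_iff split_beta)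
  have sf: "sigma_finite_measure (density lborel (\<lambda>x. ennreal (normal_density 0 (sqrt (1/2)) x)))"
    by (intro prob_space_imp_sigma_finite prob_space_normal_density) simp
  have "normal_density 0 (sqrt (1/2)) a * normal_density 0 (sqrt (1/2)) b = exp (- (norm (Complex a b))\<^sup>2) / pi" for a b
    by (simp add: normal_density_def exp_add[symmetric] cmod_def real_sqrt_mult[symmetric])
  then have "ennreal (normal_density 0 (sqrt (1/2)) a) * ennreal (normal_density 0 (sqrt (1/2)) b) = ennreal (exp (- (norm (Complex a b))\<^sup>2) / pi)" for a b
    by (simp add: ennreal_mult'[symmetric])
  then show ?thesis unfolding cnormal_def
    by (subst lborel_complex, subst pair_measure_density[OF _ _ lborel.sigma_finite_measure_axioms sf])
       (auto simp: density_distr case_prod_unfold)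
qed

text \<open>The norm of a nested vector is the Frobenius norm (\<open>norm_matrix_sq\<close>), so
  this is the product of the entrywise densities.\<close>

definition gauss :: "complex ^ 'n ^ 'm \<Rightarrow> real" where
  "gauss W = exp (- (norm W)\<^sup>2) / pi ^ (CARD('m) * CARD('n))"

lemma borel_measurable_gauss [measurable]: "gauss \<in> borel_measurable borel"
  unfolding gauss_def by measurable

lemma norm_matrix_sq: "(norm (W :: complex^'n^'m))\<^sup>2 = (\<Sum>i\<in>UNIV. \<Sum>j\<in>UNIV. (norm (W $ i $ j))\<^sup>2)"
  by (simp add: norm_vec_def L2_set_def sum_nonneg)

lemma iid_cnormal_matrix_eq_density:
  "(iid_cnormal_matrix :: (complex ^ 'n ^ 'm) measure) = density lborel (\<lambda>W. ennreal (gauss W))"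
proof -
  let ?v = "\<lambda>f. (\<chi> i j. f (i, j)) :: complex^'n^'m"
  let ?d = "\<lambda>z::complex. ennreal (exp (- (norm z)\<^sup>2) / pi)"
  interpret product_sigma_finite "\<lambda>_ :: 'm \<times> 'n. lborel :: complex measure" ..
  have [measurable]: "?v \<in> borel_measurable (PiM UNIV (\<lambda>_. lborel))"
    by (rule borel_measurable_matrix) simp
  have "sigma_finite_measure (density lborel ?d)"
    by (subst sigma_finite_measure.sigma_finite_iff_density_finite[OF sigma_finite_lborel]) auto
  then interpret D: product_sigma_finite "\<lambda>_ :: 'm \<times> 'n. density lborel ?d"
    by (simp add: product_sigma_finite_def)
  have "PiM UNIV (\<lambda>_ :: 'm \<times> 'n. density lborel ?d) = density (PiM UNIV (\<lambda>_. lborel)) (\<lambda>f. \<Prod>i\<in>UNIV. ?d (f i))"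
  proof (rule D.PiM_eqI[symmetric])
    fix A :: "'m \<times> 'n \<Rightarrow> complex set" assume A: "\<And>i. i \<in> UNIV \<Longrightarrow> A i \<in> sets (density lborel ?d)"
    then have [measurable]: "A i \<in> sets borel" for i by simp
    have "emeasure (density (PiM UNIV (\<lambda>_. lborel)) (\<lambda>f. \<Prod>i\<in>UNIV. ?d (f i))) (PiE UNIV A)
      = (\<integral>\<^sup>+f. (\<Prod>i\<in>UNIV. ?d (f i)) * indicator (PiE UNIV A) f \<partial>PiM UNIV (\<lambda>_. lborel))"
      by (intro emeasure_density sets_PiM_I_finite) auto
    also have "\<dots> = (\<integral>\<^sup>+f. (\<Prod>i\<in>UNIV. ?d (f i) * indicator (A i) (f i)) \<partial>PiM UNIV (\<lambda>_. lborel))"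
    proof (rule nn_integral_cong)
      fix f :: "'m \<times> 'n \<Rightarrow> complex"
      \<comment> \<open>The indicator of a rectangle factors over the coordinates, so the integral
        of the product density over it splits as well.\<close>
      have "indicator (PiE UNIV A) f = (\<Prod>i\<in>UNIV. indicator (A i) (f i) :: ennreal)"
      proof (cases "\<forall>i. f i \<in> A i")
        case True
        then show ?thesis by (simp add: indicator_def PiE_def Pi_def del: split_paired_All)
      next
        case False
        then obtain i where "f i \<notin> A i" by blast
        then have "(\<Prod>i\<in>UNIV. indicator (A i) (f i) :: ennreal) = 0"
          by (intro prod_zero bexI[of _ i]) auto
        with \<open>f i \<notin> A i\<close> show ?thesis by (auto simp: indicator_def PiE_def Pi_def simp del: split_paired_All)
      qed
      then show "(\<Prod>i\<in>UNIV. ?d (f i)) * indicator (PiE UNIV A) f = (\<Prod>i\<in>UNIV. ?d (f i) * indicator (A i) (f i))"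
        by (simp add: prod.distrib)
    qed
    also have "\<dots> = (\<Prod>i\<in>UNIV. \<integral>\<^sup>+z. ?d z * indicator (A i) z \<partial>lborel)"
      by (rule product_nn_integral_prod) auto
    also have "\<dots> = (\<Prod>i\<in>UNIV. emeasure (density lborel ?d) (A i))"
      by (intro prod.cong refl emeasure_density[symmetric]) auto
    finally show "emeasure (density (PiM UNIV (\<lambda>_. lborel)) (\<lambda>f. \<Prod>i\<in>UNIV. ?d (f i))) (PiE UNIV A)
      = (\<Prod>i\<in>UNIV. emeasure (density lborel ?d) (A i))" .
  qed (auto intro!: sets_PiM_cong)
  moreover have "(\<Prod>i\<in>UNIV. ?d (f i)) = ennreal (gauss (?v f))" for f :: "'m \<times> 'n \<Rightarrow> complex"
    by (simp add: prod_ennreal gauss_def norm_matrix_sq prod_dividef exp_sum sum.cartesian_product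
        sum_negf[symmetric] split_beta)
  ultimately show ?thesis
    unfolding iid_cnormal_matrix_def cnormal_eq_density
    by (subst lborel_matrix) (simp add: density_distr)
qed

section \<open>The duality bound\<close>

text \<open>
  With \<open>pY\<close> the output density, \<open>ln (p / pY) \<le> b + ln C + (q / (C * pY) - 1)\<close>, and the last term
  has nonpositive mean. If the entropy density is not integrable, the library's mutual information
  is 0, which is why \<open>b\<close> and \<open>ln C\<close> have to be nonnegative.
\<close>

lemma (in prob_space) mutual_information_le_of_density_le:
  fixes p :: "'b \<times> 'c \<Rightarrow> ennreal" and q :: "'c \<Rightarrow> ennreal" and b :: "'b \<Rightarrow> real"
  assumes [measurable]: "X \<in> measurable M S" "Y \<in> measurable M T"
    and T: "sigma_finite_measure T"
    and [measurable]: "p \<in> borel_measurable (S \<Otimes>\<^sub>M T)" "q \<in> borel_measurable T"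
    and joint: "distr M (S \<Otimes>\<^sub>M T) (\<lambda>\<omega>. (X \<omega>, Y \<omega>)) = density (distr M S X \<Otimes>\<^sub>M T) p"
    and p: "\<And>z. 0 < p z" "\<And>z. p z \<le> ennreal K"
    and pq: "\<And>x y. p (x, y) \<le> ennreal (exp (b x)) * q y"
    and q: "(\<integral>\<^sup>+y. q y \<partial>T) \<le> ennreal C" "1 \<le> C"
    and b: "integrable (distr M S X) b" "\<And>x. 0 \<le> b x"
  shows "mutual_information (exp 1) S T X Y \<le> ln C + (\<integral>x. b x \<partial>distr M S X)"
proof -
  define \<mu> where "\<mu> = distr M S X"
  define N where "N = density (\<mu> \<Otimes>\<^sub>M T) p"
  define pY where "pY y = (\<integral>\<^sup>+x. p (x, y) \<partial>\<mu>)" for y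
  interpret T: sigma_finite_measure T by fact
  interpret \<mu>: prob_space \<mu> unfolding \<mu>_def by (rule prob_space_distr) fact
  interpret P: pair_sigma_finite \<mu> T ..
  have [measurable_cong, simp]: "sets \<mu> = sets S" by (simp add: \<mu>_def)
  have [simp]: "space \<mu> = space S" by (simp add: \<mu>_def)
  have [measurable]: "pY \<in> borel_measurable T" unfolding pY_def by measurable
  have N: "N = distr M (S \<Otimes>\<^sub>M T) (\<lambda>\<omega>. (X \<omega>, Y \<omega>))"
    by (simp add: N_def joint \<mu>_def)
  interpret N: prob_space N unfolding N by (rule prob_space_distr) measurable
  \<comment> \<open>Positivity and boundedness of \<open>p\<close> place \<open>pY\<close> strictly
    between 0 and infinity: dividing by it is safe, and the measure with density \<open>pY\<close>
    is sigma-finite.\<close>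
  have pY_pos: "0 < pY y" if "y \<in> space T" for y
  proof (rule ccontr)
    assume "\<not> 0 < pY y"
    then have "(\<integral>\<^sup>+x. p (x, y) \<partial>\<mu>) = 0" by (simp add: pY_def)
    then have "AE x in \<mu>. p (x, y) = 0"
      by (subst (asm) nn_integral_0_iff_AE) (use that in measurable)
    then have "AE x in \<mu>. False" using p(1) by (auto elim!: eventually_mono simp: zero_less_iff_neq_zero)
    then show False by simp
  qed
  have pY_fin: "pY y < \<infinity>" for y
  proof -
    have "pY y \<le> (\<integral>\<^sup>+x. ennreal K \<partial>\<mu>)" unfolding pY_def by (intro nn_integral_mono p(2))
    also have "\<dots> < \<infinity>" using \<mu>.emeasure_space_1 by simp
    finally show ?thesis .
  qed
  have margY: "distr N T snd = density T pY"
  proof (rule measure_eqI)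
    fix A assume "A \<in> sets (distr N T snd)"
    then have A[measurable]: "A \<in> sets T" by simp
    have "emeasure (distr N T snd) A = (\<integral>\<^sup>+z. indicator A (snd z) \<partial>N)"
      by (subst nn_integral_indicator[symmetric], simp, subst nn_integral_distr) (simp_all add: N)
    also have "\<dots> = (\<integral>\<^sup>+z. p z * indicator A (snd z) \<partial>(\<mu> \<Otimes>\<^sub>M T))"
      unfolding N_def by (rule nn_integral_density) measurable
    also have "\<dots> = (\<integral>\<^sup>+y. (\<integral>\<^sup>+x. p (x, y) * indicator A y \<partial>\<mu>) \<partial>T)"
      by (subst P.nn_integral_snd[symmetric]) auto
    also have "\<dots> = (\<integral>\<^sup>+y. pY y * indicator A y \<partial>T)"
      unfolding pY_def by (intro nn_integral_cong nn_integral_multc) measurable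
    finally show "emeasure (distr N T snd) A = emeasure (density T pY) A"
      by (simp add: emeasure_density)
  qed simp
  have distrY: "distr M T Y = density T pY"
    unfolding margY[symmetric] N by (subst distr_distr) (auto simp: comp_def)
  have fstN: "distr N S fst = \<mu>"
    unfolding \<mu>_def N by (subst distr_distr) (auto simp: comp_def)
  have sf: "sigma_finite_measure (density T pY)"
    using pY_fin by (subst T.sigma_finite_iff_density_finite) (auto simp: less_top)
  define Q where "Q = \<mu> \<Otimes>\<^sub>M density T pY"
  have Qd: "Q = density (\<mu> \<Otimes>\<^sub>M T) (\<lambda>z. pY (snd z))"
    unfolding Q_def using pair_measure_density[of "\<lambda>_. 1" \<mu> pY T, OF _ _ T sf]
    by (simp add: density_1 case_prod_unfold)
  interpret Q: pair_sigma_finite \<mu> "density T pY"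
    using sf by (simp add: pair_sigma_finite_def \<mu>.sigma_finite_measure_axioms)
  \<comment> \<open>The candidate for the density of the joint law \<open>N\<close> with respect to
    the product \<open>Q\<close> of the marginals; uniqueness of the Radon-Nikodym derivative
    identifies the two almost everywhere.\<close>
  define R where "R z = p z / pY (snd z)" for z
  have [measurable]: "R \<in> borel_measurable (S \<Otimes>\<^sub>M T)" unfolding R_def by measurable
  have "density Q R = N"
    unfolding Qd N_def
  proof (subst density_density_eq)
    show "density (\<mu> \<Otimes>\<^sub>M T) (\<lambda>z. pY (snd z) * R z) = density (\<mu> \<Otimes>\<^sub>M T) p"
    proof (intro density_cong AE_I2)
      fix z assume z: "z \<in> space (\<mu> \<Otimes>\<^sub>M T)"
      then have "pY (snd z) \<noteq> 0" "pY (snd z) \<noteq> \<infinity>"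
        using pY_pos[of "snd z"] pY_fin[of "snd z"] by (auto simp: space_pair_measure)
      then show "pY (snd z) * R z = p z"
        unfolding R_def by (metis ennreal_mult_divide_eq ennreal_times_divide infinity_ennreal_def mult.commute)
    qed measurable
  qed measurable
  moreover have "R \<in> borel_measurable Q" unfolding Q_def by measurable
  ultimately have RN: "AE z in Q. R z = RN_deriv Q N z"
    unfolding Q_def using Q.RN_deriv_unique by (simp add: Q_def)
  have "AE z in N. R z = RN_deriv Q N z"
    using RN \<open>density Q R = N\<close>[symmetric] \<open>R \<in> borel_measurable Q\<close> by (auto simp: AE_density)
  \<comment> \<open>Integrability allows \<open>q\<close> to be infinite only on a null set; outside
    it the pointwise estimate can be carried out in the reals.\<close>
  moreover have "AE z in N. q (snd z) \<noteq> \<infinity>"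
  proof -
    have "AE y in T. q y \<noteq> \<infinity>"
      using q(1) by (intro nn_integral_noteq_infinite) (auto simp: top_unique)
    then have "AE y in density T pY. q y \<noteq> \<infinity>"
      by (subst AE_density) auto
    then show ?thesis
      unfolding margY[symmetric] by (subst (asm) AE_distr_iff) (auto simp: N)
  qed
  moreover have "AE z in N. z \<in> space (S \<Otimes>\<^sub>M T)"
    using AE_space[of N] by (simp add: N)
  ultimately have bound: "AE z in N. entropy_density (exp 1) Q N z
      \<le> b (fst z) + ln C + (enn2real (q (snd z) / (C * pY (snd z))) - 1)"
  proof eventually_elim
    case (elim z)
    obtain x y where z: "z = (x, y)" by fastforce
    with elim have y: "y \<in> space T" by (auto simp: space_pair_measure)
    obtain r where r: "p (x, y) = ennreal r" "0 < r"
      using p(1)[of "(x, y)"] p(2)[of "(x, y)"]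
      by (cases "p (x, y)") (auto simp: top_unique)
    obtain s where s: "pY y = ennreal s" "0 < s"
      using pY_pos[OF y] pY_fin[of y] by (cases "pY y") auto
    obtain t where t: "q y = ennreal t" "0 \<le> t"
      using elim z by (cases "q y") auto
    have "r \<le> exp (b x) * t"
      using pq[of x y] r t by (simp add: ennreal_mult'[symmetric])
    with r have tpos: "0 < t" by (smt (verit) exp_gt_zero mult_nonneg_nonpos zero_less_mult_iff)
    have "entropy_density (exp 1) Q N z = ln (r / s)"
      using elim(1)[symmetric] r s unfolding entropy_density_def z R_def
      by (simp add: divide_ennreal log_def)
    also have "\<dots> \<le> ln (exp (b x) * t / s)"
      using r s \<open>r \<le> exp (b x) * t\<close> by (simp add: divide_right_mono)
    also have "\<dots> = b x + ln C + ln (t / (C * s))"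
      using tpos s q(2) by (simp add: ln_div ln_mult)
    \<comment> \<open>Linearizing the logarithm leaves a term whose mean under the output law can be
      computed.\<close>
    also have "\<dots> \<le> b x + ln C + (t / (C * s) - 1)"
      using tpos s q(2) ln_le_minus_one[of "t / (C * s)"] by simp
    also have "t / (C * s) = enn2real (q y / (ennreal C * pY y))"
      using tpos s q(2) t by (simp add: divide_ennreal ennreal_mult'[symmetric])
    finally show ?case by (simp add: z)
  qed
  \<comment> \<open>The output law has density \<open>pY\<close>, which cancels the denominator and
    leaves the integral of \<open>q\<close> divided by \<open>C\<close>. It is only an inequality
    because \<open>enn2real\<close> sends infinity to 0.\<close>
  have hint: "(\<integral>\<^sup>+z. ennreal (enn2real (q (snd z) / (C * pY (snd z)))) \<partial>N) \<le> 1"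
  proof -
    have "(\<integral>\<^sup>+z. ennreal (enn2real (q (snd z) / (C * pY (snd z)))) \<partial>N)
      = (\<integral>\<^sup>+y. ennreal (enn2real (q y / (C * pY y))) \<partial>density T pY)"
      unfolding margY[symmetric] by (subst nn_integral_distr) (auto simp: N)
    also have "\<dots> = (\<integral>\<^sup>+y. pY y * ennreal (enn2real (q y / (C * pY y))) \<partial>T)"
      by (rule nn_integral_density) measurable
    also have "\<dots> \<le> (\<integral>\<^sup>+y. q y / ennreal C \<partial>T)"
    proof (rule nn_integral_mono)
      fix y assume "y \<in> space T"
      then obtain s where s: "pY y = ennreal s" "0 < s"
        using pY_pos[of y] pY_fin[of y] by (cases "pY y") auto
      show "pY y * ennreal (enn2real (q y / (C * pY y))) \<le> q y / ennreal C"
      proof (cases "q y")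
        case (real t)
        then show ?thesis using s q(2)
          by (simp add: divide_ennreal ennreal_mult'[symmetric] field_simps)
      next
        case top
        then show ?thesis using q(2) by (simp add: ennreal_top_divide)
      qed
    qed
    also have "\<dots> = (\<integral>\<^sup>+y. q y \<partial>T) / ennreal C"
      by (rule nn_integral_divide) measurable
    also have "\<dots> \<le> ennreal C / ennreal C"
      by (intro divide_right_mono_ennreal q)
    also have "\<dots> = 1" using q(2) by (simp add: divide_ennreal)
    finally show ?thesis .
  qed
  have hi: "integrable N (\<lambda>z. enn2real (q (snd z) / (C * pY (snd z))))"
    using hint by (intro integrableI_nonneg) (auto simp: N le_less_trans)
  have hle: "(\<integral>z. enn2real (q (snd z) / (C * pY (snd z))) \<partial>N) \<le> 1"
    using hint by (subst (asm) nn_integral_eq_integral[OF hi]) auto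
  have [measurable]: "b \<in> borel_measurable S"
    using borel_measurable_integrable[OF b(1)] by simp
  have bi: "integrable N (\<lambda>z. b (fst z))"
    using b(1) unfolding \<mu>_def[symmetric] fstN[symmetric] by (subst (asm) integrable_distr_eq) (auto simp: N)
  have be: "(\<integral>z. b (fst z) \<partial>N) = (\<integral>x. b x \<partial>\<mu>)"
    using b(1) unfolding \<mu>_def[symmetric] by (subst fstN[symmetric], subst integral_distr) (auto simp: N fstN)
  have "mutual_information (exp 1) S T X Y = (\<integral>z. entropy_density (exp 1) Q N z \<partial>N)"
    unfolding mutual_information_def KL_divergence_def Q_def N \<mu>_def distrY by simp
  also have "\<dots> \<le> ln C + (\<integral>x. b x \<partial>\<mu>)"
  proof (cases "integrable N (entropy_density (exp 1) Q N)")
    case True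
    have "(\<integral>z. entropy_density (exp 1) Q N z \<partial>N)
        \<le> (\<integral>z. b (fst z) + ln C + (enn2real (q (snd z) / (C * pY (snd z))) - 1) \<partial>N)"
      using True bound hi bi by (intro integral_mono_AE) auto
    also have "\<dots> = (\<integral>x. b x \<partial>\<mu>) + ln C + ((\<integral>z. enn2real (q (snd z) / (C * pY (snd z))) \<partial>N) - 1)"
      using hi bi be by (simp add: N.prob_space)
    finally show ?thesis using hle by simp
  next
    case False
    then show ?thesis using b(2) q(2) by (simp add: not_integrable_integral_eq)
  qed
  finally show ?thesis by (simp add: \<mu>_def)
qed

section \<open>The channel\<close>

lemma borel_measurable_vec_nth [measurable (raw)]:
  fixes f :: "'b \<Rightarrow> 'a::euclidean_space^'n"
  assumes "f \<in> borel_measurable M"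
  shows "(\<lambda>x. f x $ i) \<in> borel_measurable M"
  by (rule measurable_compose[OF assms]) (intro borel_measurable_continuous_onI continuous_intros)

lemma gauss_pos: "0 < gauss W"
  by (simp add: gauss_def)

lemma gauss_le_1: "gauss (W :: complex ^ 'n ^ 'm) \<le> 1"
proof -
  have "1 \<le> pi ^ (CARD('m) * CARD('n))" using pi_ge_two by (intro one_le_power) simp
  then show ?thesis
    unfolding gauss_def by (subst divide_le_eq_1_pos) (auto intro: order_trans[of _ 1])
qed

lemma prob_space_iid_cnormal_matrix:
  "prob_space (iid_cnormal_matrix :: (complex ^ 'n ^ 'm) measure)"
proof -
  have "prob_space cnormal"
    unfolding cnormal_def
  proof (rule prob_space.prob_space_distr)
    have "prob_space (density lborel (normal_density 0 (sqrt (1 / 2))))"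
      by (rule prob_space_normal_density) simp
    then show "prob_space (density lborel (\<lambda>x. ennreal (normal_density 0 (sqrt (1 / 2)) x)) \<Otimes>\<^sub>M
        density lborel (\<lambda>x. ennreal (normal_density 0 (sqrt (1 / 2)) x)))"
      by (intro prob_space_pair)
  qed (auto simp: borel_measurable_complex_iff split_beta)
  moreover have [measurable_cong]: "sets cnormal = sets borel" by (simp add: cnormal_def)
  ultimately show ?thesis
    unfolding iid_cnormal_matrix_def
    by (intro prob_space.prob_space_distr prob_space_PiM borel_measurable_matrix) auto
qed

lemma nn_integral_gauss: "(\<integral>\<^sup>+W. ennreal (gauss W) \<partial>lborel) = 1"
proof -
  interpret prob_space "iid_cnormal_matrix :: (complex ^ 'n ^ 'm) measure"
    by (rule prob_space_iid_cnormal_matrix)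
  show "(\<integral>\<^sup>+W. ennreal (gauss (W :: complex ^ 'n ^ 'm)) \<partial>lborel) = 1"
    using emeasure_space_1 by (simp add: iid_cnormal_matrix_eq_density emeasure_density)
qed

text \<open>The noiseless output. It is linear in \<open>x\<close> and in \<open>S\<close>
  separately, so \<open>x\<close> and \<open>S\<close> can exchange a scalar factor without changing
  it.\<close>

definition signal :: "complex ^ 'q ^ 'n \<Rightarrow> complex ^ 'n \<Rightarrow> complex ^ 'q ^ 'm \<Rightarrow> complex ^ 'n ^ 'm" where
  "signal P x S = S ** transpose P ** diag_vec x"

lemma signal_nth: "signal P x S $ i $ j = (\<Sum>k\<in>UNIV. S $ i $ k * P $ j $ k) * x $ j"
proof -
  have "signal P x S $ i $ j = (\<Sum>l\<in>UNIV. if l = j then (\<Sum>k\<in>UNIV. S $ i $ k * P $ j $ k) * x $ j else 0)"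
    unfolding signal_def diag_vec_def matrix_matrix_mult_def transpose_def
    by (simp only: vec_lambda_beta) (intro sum.cong, auto)
  then show ?thesis by simp
qed

lemma borel_measurable_signal [measurable (raw)]:
  assumes [measurable]: "f \<in> borel_measurable M" "g \<in> borel_measurable M"
  shows "(\<lambda>z. signal P (f z) (g z)) \<in> borel_measurable M"
  by (rule borel_measurable_matrix) (simp add: signal_nth)

text \<open>The conditional density of \<open>Y\<close> given \<open>x\<close>: for fixed
  \<open>S\<close> the output is a translate of the noise, and \<open>gauss S\<close> averages over
  the fading.\<close>

definition channel_density ::
  "complex ^ 'q ^ 'n \<Rightarrow> (complex ^ 'n) \<times> (complex ^ 'n ^ 'm) \<Rightarrow> ennreal" where
  "channel_density P = (\<lambda>(x, Y). \<integral>\<^sup>+S. ennreal (gauss S * gauss (Y - signal P x S)) \<partial>lborel)"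

lemma channel_density_measurable [measurable]:
  "channel_density P \<in> borel_measurable (borel \<Otimes>\<^sub>M borel)"
  unfolding channel_density_def by measurable

lemma channel_density_pos: "0 < channel_density P z"
proof (rule ccontr)
  assume *: "\<not> 0 < channel_density P z"
  obtain x Y where z: "z = (x, Y)" by fastforce
  from * have "(\<integral>\<^sup>+S. ennreal (gauss S * gauss (Y - signal P x S)) \<partial>lborel) = 0"
    by (simp add: channel_density_def z)
  then have "AE S in lborel. ennreal (gauss (S :: complex^'a^'c) * gauss (Y - signal P x S)) = 0"
    by (subst (asm) nn_integral_0_iff_AE) measurable
  then have "AE S in (lborel :: (complex^'a^'c) measure). False"
    by eventually_elim (metis ennreal_eq_0_iff gauss_pos mult_pos_pos not_le)
  then show False by (simp add: ae_filter_eq_bot_iff)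
qed

lemma channel_density_le:
  fixes P :: "complex ^ 'q ^ 'n" and z :: "(complex ^ 'n) \<times> (complex ^ 'n ^ 'm)"
  shows "channel_density P z \<le> ennreal 1"
proof -
  obtain x Y where z: "z = (x, Y)" by fastforce
  have "channel_density P z \<le> (\<integral>\<^sup>+S. ennreal (gauss (S :: complex ^ 'q ^ 'm)) \<partial>lborel)"
    unfolding channel_density_def z prod.case
    by (intro nn_integral_mono ennreal_leI mult_left_le gauss_le_1 less_imp_le[OF gauss_pos])
  then show ?thesis by (simp add: nn_integral_gauss)
qed

text \<open>For fixed \<open>x\<close> and \<open>S\<close>, substituting \<open>Y\<close> for
  \<open>signal P x S + W\<close> turns the noise density into a density of the output; Tonelli then
  moves the integral over \<open>S\<close> inside.\<close>

lemma distr_joint_law: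
  fixes mu :: "(complex ^ 'n) measure" and P :: "complex ^ 'q ^ 'n"
  assumes mu: "prob_space mu" and [measurable_cong, simp]: "sets mu = sets borel"
  defines "J \<equiv> joint_law mu :: (_ \<times> (complex ^ 'q ^ 'm) \<times> _) measure"
  shows "distr J borel fst = mu"
    and "distr J (borel \<Otimes>\<^sub>M borel) (\<lambda>\<omega>. (fst \<omega>, (\<lambda>(x, S, W). channel_out P x S W) \<omega>))
        = density (mu \<Otimes>\<^sub>M lborel) (channel_density P)"
proof -
  interpret mu: prob_space mu by fact
  let ?S = "iid_cnormal_matrix :: (complex ^ 'q ^ 'm) measure"
  let ?W = "iid_cnormal_matrix :: (complex ^ 'n ^ 'm) measure"
  have [measurable_cong, simp]: "sets ?S = sets borel" "sets ?W = sets borel"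
    by (simp_all add: iid_cnormal_matrix_def)
  interpret S: prob_space ?S by (rule prob_space_iid_cnormal_matrix)
  interpret W: prob_space ?W by (rule prob_space_iid_cnormal_matrix)
  interpret SW: pair_prob_space ?S ?W ..
  interpret J: pair_prob_space mu "?S \<Otimes>\<^sub>M ?W" ..
  show "distr J borel fst = mu"
  proof (rule measure_eqI)
    fix A assume "A \<in> sets (distr J borel fst)"
    then have A: "A \<in> sets mu" by simp
    have "fst -` A \<inter> space J = A \<times> space (?S \<Otimes>\<^sub>M ?W)"
      using sets.sets_into_space[OF A] by (auto simp: J_def joint_law_def space_pair_measure)
    then show "emeasure (distr J borel fst) A = emeasure mu A"
      using A SW.P.emeasure_space_1 SW.P.emeasure_pair_measure_Times[OF A sets.top]
      by (subst emeasure_distr) (auto simp: J_def joint_law_def)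
  qed (simp add: J_def)
  let ?F = "\<lambda>\<omega>. (fst \<omega>, (\<lambda>(x, S, W). channel_out P x S W) \<omega>) :: (complex^'n) \<times> (complex^'n^'m)"
  have F: "?F (x, S, W) = (x, signal P x S + W)" for x S W
    by (simp add: channel_out_def signal_def)
  have Fm[measurable]: "?F \<in> measurable (mu \<Otimes>\<^sub>M (?S \<Otimes>\<^sub>M ?W)) (borel \<Otimes>\<^sub>M borel)"
    unfolding channel_out_def signal_def[symmetric] by measurable
  show "distr J (borel \<Otimes>\<^sub>M borel) ?F = density (mu \<Otimes>\<^sub>M lborel) (channel_density P)"
  proof (rule measure_eqI)
    fix A assume "A \<in> sets (distr J (borel \<Otimes>\<^sub>M borel) ?F)"
    then have A[measurable]: "A \<in> sets (borel \<Otimes>\<^sub>M borel)" by simp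
    have "emeasure (distr J (borel \<Otimes>\<^sub>M borel) ?F) A = (\<integral>\<^sup>+\<omega>. indicator A (?F \<omega>) \<partial>(mu \<Otimes>\<^sub>M (?S \<Otimes>\<^sub>M ?W)))"
      by (subst nn_integral_indicator[symmetric], simp, subst nn_integral_distr)
        (simp_all add: J_def joint_law_def)
    also have "\<dots> = (\<integral>\<^sup>+x. \<integral>\<^sup>+SW. indicator A (?F (x, SW)) \<partial>(?S \<Otimes>\<^sub>M ?W) \<partial>mu)"
      by (rule SW.P.nn_integral_fst[symmetric]) measurable
    also have "\<dots> = (\<integral>\<^sup>+x. \<integral>\<^sup>+S. \<integral>\<^sup>+W. indicator A (x, signal P x S + W) \<partial>?W \<partial>?S \<partial>mu)"
      by (subst W.nn_integral_fst[symmetric]) (auto simp: channel_out_def signal_def[symmetric] split_beta)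
    also have "\<dots> = (\<integral>\<^sup>+x. \<integral>\<^sup>+Y. channel_density P (x, Y) * indicator A (x, Y) \<partial>lborel \<partial>mu)"
    proof (rule nn_integral_cong)
      fix x
      have "(\<integral>\<^sup>+S. \<integral>\<^sup>+W. indicator A (x, signal P x S + W) \<partial>?W \<partial>?S)
        = (\<integral>\<^sup>+S. ennreal (gauss S) * (\<integral>\<^sup>+W. ennreal (gauss W) * indicator A (x, signal P x S + W) \<partial>lborel) \<partial>lborel)"
        unfolding iid_cnormal_matrix_eq_density by (simp add: nn_integral_density)
      also have "\<dots> = (\<integral>\<^sup>+S. ennreal (gauss S) * (\<integral>\<^sup>+Y. ennreal (gauss (Y - signal P x S)) * indicator A (x, Y) \<partial>lborel) \<partial>lborel)"
      proof (rule nn_integral_cong)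
        fix S :: "complex^'q^'m"
        show "ennreal (gauss S) * (\<integral>\<^sup>+W. ennreal (gauss W) * indicator A (x, signal P x S + W) \<partial>lborel)
          = ennreal (gauss S) * (\<integral>\<^sup>+Y. ennreal (gauss (Y - signal P x S)) * indicator A (x, Y) \<partial>lborel)"
          using nn_integral_lborel_translate[of "\<lambda>Y. ennreal (gauss (Y - signal P x S)) * indicator A (x, Y)" "signal P x S"]
          by simp
      qed
      also have "\<dots> = (\<integral>\<^sup>+S. \<integral>\<^sup>+Y. ennreal (gauss S * gauss (Y - signal P x S)) * indicator A (x, Y) \<partial>lborel \<partial>lborel)"
        by (intro nn_integral_cong, subst nn_integral_cmult[symmetric])
          (auto simp: ennreal_mult' gauss_pos less_imp_le mult.assoc)
      also have "\<dots> = (\<integral>\<^sup>+Y. \<integral>\<^sup>+S. ennreal (gauss S * gauss (Y - signal P x S)) * indicator A (x, Y) \<partial>lborel \<partial>lborel)"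
        by (rule lborel_pair.Fubini') measurable
      also have "\<dots> = (\<integral>\<^sup>+Y. channel_density P (x, Y) * indicator A (x, Y) \<partial>lborel)"
        unfolding channel_density_def prod.case
        by (intro nn_integral_cong nn_integral_multc) measurable
      finally show "(\<integral>\<^sup>+S. \<integral>\<^sup>+W. indicator A (x, signal P x S + W) \<partial>?W \<partial>?S) = \<dots>" .
    qed
    also have "\<dots> = (\<integral>\<^sup>+z. channel_density P z * indicator A z \<partial>(mu \<Otimes>\<^sub>M lborel))"
      by (rule lborel.nn_integral_fst) measurable
    also have "\<dots> = emeasure (density (mu \<Otimes>\<^sub>M lborel) (channel_density P)) A"
      by (rule emeasure_density[symmetric]) measurable
    finally show "emeasure (distr J (borel \<Otimes>\<^sub>M borel) ?F) A = \<dots>" .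
  qed (auto simp: J_def intro!: sets_pair_measure_cong)
qed

text \<open>The duality bound with \<open>b x = B * ln (1 + (norm x)\<^sup>2)\<close>; the power
  constraint enters only through the mean of this logarithm.\<close>

lemma mi_xY_le:
  fixes rho :: real and mu :: "(complex ^ 'n) measure" and P :: "complex ^ 'q ^ 'n"
    and q :: "complex ^ 'n ^ 'm \<Rightarrow> ennreal"
  assumes mu: "admissible_input rho mu" and "0 < rho" "0 \<le> B" "1 \<le> C"
    and [measurable]: "q \<in> borel_measurable borel"
    and q: "(\<integral>\<^sup>+Y. q Y \<partial>lborel) \<le> ennreal C"
    and le: "\<And>x Y. channel_density P (x, Y) \<le> ennreal ((1 + (norm x)\<^sup>2) powr B) * q Y"
  shows "mi_xY P mu TYPE('m) \<le> ln C + B * (ln (1 + CARD('n) * rho) + 1)"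
proof -
  have "prob_space mu" and [measurable_cong, simp]: "sets mu = sets borel"
    and pow: "(\<integral>\<^sup>+ x. ennreal ((norm x)\<^sup>2) \<partial>mu) \<le> ennreal (real CARD('n) * rho)"
    using mu by (auto simp: admissible_input_def)
  interpret mu: prob_space mu by fact
  have int: "integrable mu (\<lambda>x. (norm x)\<^sup>2)"
    using pow by (intro integrableI_nonneg) (auto simp: le_less_trans)
  have pow': "(\<integral>x. (norm x)\<^sup>2 \<partial>mu) \<le> real CARD('n) * rho"
    using pow \<open>0 < rho\<close> by (subst (asm) nn_integral_eq_integral[OF int]) auto
  define J where "J = (joint_law mu :: (_ \<times> (complex ^ 'q ^ 'm) \<times> (complex ^ 'n ^ 'm)) measure)"
  let ?S = "iid_cnormal_matrix :: (complex ^ 'q ^ 'm) measure"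
  let ?W = "iid_cnormal_matrix :: (complex ^ 'n ^ 'm) measure"
  have [measurable_cong, simp]: "sets ?S = sets borel" "sets ?W = sets borel"
    by (simp_all add: iid_cnormal_matrix_def)
  interpret J: prob_space J
    unfolding J_def joint_law_def
    by (intro prob_space_pair prob_space_iid_cnormal_matrix \<open>prob_space mu\<close>)
  \<comment> \<open>The largest value the constraint allows for the mean of
    \<open>1 + (norm x)\<^sup>2\<close>. The tangent to the logarithm at \<open>L\<close> takes the
    place of Jensen's inequality and costs at most the additive 1.\<close>
  define L where "L = 1 + CARD('n) * rho"
  have L: "0 < L" using \<open>0 < rho\<close> by (auto simp: L_def intro: add_pos_nonneg)
  have ln_int: "integrable mu (\<lambda>x. ln (1 + (norm x)\<^sup>2))"
    by (rule Bochner_Integration.integrable_bound[OF int]) (auto intro!: ln_add_one_self_le_self)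
  have "(\<integral>x. ln (1 + (norm x)\<^sup>2) \<partial>mu) \<le> (\<integral>x. ln L + (norm x)\<^sup>2 / L \<partial>mu)"
  proof (rule integral_mono[OF ln_int])
    fix x :: "complex ^ 'n"
    have "ln ((1 + (norm x)\<^sup>2) / L) \<le> (1 + (norm x)\<^sup>2) / L - 1"
      using L by (intro ln_le_minus_one divide_pos_pos) (auto intro: add_pos_nonneg)
    moreover have "1 / L \<le> 1"
      using \<open>0 < rho\<close> L by (subst divide_le_eq_1_pos) (simp_all add: L_def)
    moreover have "ln ((1 + (norm x)\<^sup>2) / L) = ln (1 + (norm x)\<^sup>2) - ln L"
      using L add_pos_nonneg[of 1 "(norm x)\<^sup>2"] by (simp add: ln_div)
    ultimately show "ln (1 + (norm x)\<^sup>2) \<le> ln L + (norm x)\<^sup>2 / L"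
      by (simp add: add_divide_distrib)
  qed (use int in auto)
  also have "\<dots> = ln L + (\<integral>x. (norm x)\<^sup>2 \<partial>mu) / L"
    using int by (simp add: mu.prob_space)
  also have "\<dots> \<le> ln L + 1"
    using pow' L by (simp add: L_def divide_le_eq_1)
  finally have ln_le: "(\<integral>x. ln (1 + (norm x)\<^sup>2) \<partial>mu) \<le> ln L + 1" .
  have "mi_xY P mu TYPE('m) = J.mutual_information (exp 1) borel borel fst (\<lambda>(x, S, W). channel_out P x S W)"
    unfolding mi_xY_def J_def ..
  \<comment> \<open>Mutual information sees only the sigma-algebra of the target, while the duality
    bound needs Lebesgue measure there as reference measure.\<close>
  also have "\<dots> = J.mutual_information (exp 1) borel lborel fst (\<lambda>(x, S, W). channel_out P x S W)"
    unfolding J.mutual_information_def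
    by (intro arg_cong2[where f="KL_divergence _"] arg_cong2[where f=pair_measure] distr_cong refl sets_pair_measure_cong) auto
  also have "\<dots> \<le> ln C + (\<integral>x. B * ln (1 + (norm x)\<^sup>2) \<partial>distr J borel fst)"
  proof (rule J.mutual_information_le_of_density_le)
    show "fst \<in> J \<rightarrow>\<^sub>M borel" "(\<lambda>(x, S, W). channel_out P x S W) \<in> J \<rightarrow>\<^sub>M lborel"
      unfolding J_def joint_law_def channel_out_def signal_def[symmetric] by measurable
    show "channel_density P \<in> borel_measurable (borel \<Otimes>\<^sub>M lborel)" by measurable
    have "distr J (borel \<Otimes>\<^sub>M lborel) (\<lambda>\<omega>. (fst \<omega>, (\<lambda>(x, S, W). channel_out P x S W) \<omega>))
      = distr J (borel \<Otimes>\<^sub>M borel) (\<lambda>\<omega>. (fst \<omega>, (\<lambda>(x, S, W). channel_out P x S W) \<omega>))"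
      by (intro distr_cong refl sets_pair_measure_cong) auto
    then show "distr J (borel \<Otimes>\<^sub>M lborel) (\<lambda>\<omega>. (fst \<omega>, (\<lambda>(x, S, W). channel_out P x S W) \<omega>))
      = density (distr J borel fst \<Otimes>\<^sub>M lborel) (channel_density P)"
      unfolding J_def distr_joint_law[OF \<open>prob_space mu\<close> \<open>sets mu = sets borel\<close>] by simp
    show "channel_density P z \<le> ennreal 1" for z :: "(complex ^ 'n) \<times> (complex ^ 'n ^ 'm)"
      by (rule channel_density_le)
    show "channel_density P (x, Y) \<le> ennreal (exp (B * ln (1 + (norm x)\<^sup>2))) * q Y" for x Y
      using le[of x Y] by (simp add: powr_def add_pos_nonneg less_imp_neq[symmetric])
    show "integrable (distr J borel fst) (\<lambda>x. B * ln (1 + (norm x)\<^sup>2))"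
      using ln_int unfolding J_def distr_joint_law[OF \<open>prob_space mu\<close> \<open>sets mu = sets borel\<close>] by simp
  qed (use assms channel_density_pos in \<open>auto intro: sigma_finite_lborel\<close>)
  also have "\<dots> = ln C + B * (\<integral>x. ln (1 + (norm x)\<^sup>2) \<partial>mu)"
    unfolding J_def distr_joint_law[OF \<open>prob_space mu\<close> \<open>sets mu = sets borel\<close>] by simp
  also have "\<dots> \<le> ln C + B * (ln L + 1)"
    using ln_le \<open>0 \<le> B\<close> by (intro add_left_mono mult_left_mono)
  finally show ?thesis by (simp add: L_def)
qed

section \<open>Heavy tails and Gaussian integrals\<close>

text \<open>Dyadic shells: where \<open>norm x\<close> lies between \<open>2 ^ (k - 1)\<close> and
  \<open>2 ^ k\<close>, the function is at most \<open>4 powr - \<beta>\<close> to the power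
  \<open>k - 1\<close>, and the ball containing the shell has volume of order
  \<open>2 ^ (k * d)\<close>. The resulting geometric series has ratio \<open>r\<close>, which is
  below 1 because the dimension is below \<open>2 * \<beta>\<close>. The factor
  \<open>4 powr \<beta>\<close> in \<open>f\<close> makes up for the index shift.\<close>

lemma nn_integral_powr_finite:
  assumes "real DIM('a) < 2 * \<beta>"
  shows "(\<integral>\<^sup>+x. ennreal ((1 + (norm (x::'a::euclidean_space))\<^sup>2) powr - \<beta>) \<partial>lborel) < \<infinity>"
proof -
  define d where "d = DIM('a)"
  define V where "V = unit_ball_vol (real d)"
  define r where "r = 2 ^ d * 4 powr - \<beta>"
  define f where "f k x = ennreal (4 powr \<beta> * (4 powr - \<beta>) ^ k) * indicator (ball (0::'a) (2 ^ k)) x" for k x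
  have "0 < \<beta>" using assms by (smt (verit) of_nat_0_le_iff)
  have [measurable]: "f k \<in> borel_measurable borel" for k
    unfolding f_def by (intro borel_measurable_times_ennreal borel_measurable_indicator borel_measurable_const) auto
  have f_le: "ennreal ((1 + (norm x)\<^sup>2) powr - \<beta>) \<le> (\<Sum>k. f k x)" for x :: 'a
  proof -
    obtain k0 :: nat where "norm x < 2 ^ k0"
      using real_arch_pow[of 2 "norm x"] by auto
    define k where "k = (LEAST k. norm x < 2 ^ k)"
    have k: "norm x < 2 ^ k" unfolding k_def by (rule LeastI) fact
    have "(1 + (norm x)\<^sup>2) powr - \<beta> \<le> 4 powr \<beta> * (4 powr - \<beta>) ^ k"
    proof (cases k)
      case 0
      have "(1 + (norm x)\<^sup>2) powr - \<beta> \<le> 1 powr - \<beta>"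
        using \<open>0 < \<beta>\<close> by (intro powr_mono2') auto
      also have "\<dots> \<le> 4 powr \<beta>" using \<open>0 < \<beta>\<close> by (simp add: ge_one_powr_ge_zero)
      finally show ?thesis using 0 by simp
    next
      case (Suc j)
      then have "\<not> norm x < 2 ^ j" unfolding k_def by (intro not_less_Least) simp
      then have "2 ^ j \<le> norm x" by simp
      then have "(2 ^ j)\<^sup>2 \<le> (norm x)\<^sup>2" by (intro power_mono) auto
      moreover have "(2 ^ j)\<^sup>2 = (4::real) ^ j" by (simp add: power2_eq_square power_mult_distrib[symmetric])
      ultimately have "(1 + (norm x)\<^sup>2) powr - \<beta> \<le> (4 ^ j) powr - \<beta>"
        using \<open>0 < \<beta>\<close> by (intro powr_mono2') auto
      also have "\<dots> = (4 powr - \<beta>) ^ j"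
      proof -
        have "(4 ^ j) powr - \<beta> = (4 powr real j) powr - \<beta>" by (simp add: powr_realpow)
        also have "\<dots> = (4 powr - \<beta>) powr real j" by (simp only: powr_powr mult.commute)
        also have "\<dots> = (4 powr - \<beta>) ^ j" by (rule powr_realpow) simp
        finally show ?thesis .
      qed
      also have "\<dots> = 4 powr \<beta> * (4 powr - \<beta>) ^ k"
      proof -
        have "4 powr \<beta> * 4 powr - \<beta> = (1::real)" by (simp add: powr_add[symmetric])
        then show ?thesis by (simp add: Suc mult.assoc[symmetric])
      qed
      finally show ?thesis .
    qed
    then have "ennreal ((1 + (norm x)\<^sup>2) powr - \<beta>) \<le> f k x"
      using k by (simp add: f_def ennreal_leI)
    also have "\<dots> \<le> (\<Sum>k. f k x)"
      using sum_le_suminf[of "\<lambda>k. f k x" "{k}"] by (simp add: summableI)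
    finally show ?thesis .
  qed
  have int_f: "(\<integral>\<^sup>+x. f k x \<partial>lborel) = ennreal (4 powr \<beta> * V * r ^ k)" for k
  proof -
    have "(\<integral>\<^sup>+x. f k x \<partial>lborel) = ennreal (4 powr \<beta> * (4 powr - \<beta>) ^ k) * ennreal (V * (2 ^ k) ^ d)"
      unfolding f_def by (subst nn_integral_cmult_indicator) (auto simp: emeasure_ball V_def d_def)
    also have "\<dots> = ennreal (4 powr \<beta> * (4 powr - \<beta>) ^ k * (V * (2 ^ k) ^ d))"
      by (rule ennreal_mult[symmetric]) (auto simp: V_def)
    also have "4 powr \<beta> * (4 powr - \<beta>) ^ k * (V * (2 ^ k) ^ d) = 4 powr \<beta> * V * r ^ k"
      by (simp add: r_def power_mult_distrib power_commutes power_mult[symmetric] mult.commute[of d k])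
    finally show ?thesis .
  qed
  have "r < 1"
  proof -
    have "4 powr - \<beta> = 2 powr (2 * - \<beta>)" using powr_powr[of 2 2 "- \<beta>"] by simp
    moreover have "(2::real) ^ d = 2 powr real d" by (simp add: powr_realpow)
    ultimately have "r = 2 powr (real d - 2 * \<beta>)"
      unfolding r_def by (simp only: powr_add[symmetric]) simp
    also have "\<dots> < 2 powr 0" using assms by (intro powr_less_mono) (auto simp: d_def)
    finally show ?thesis by simp
  qed
  moreover have "0 \<le> r" by (simp add: r_def)
  ultimately have "summable (\<lambda>k. 4 powr \<beta> * V * r ^ k)"
    by (intro summable_mult summable_geometric) simp
  then have "(\<Sum>k. ennreal (4 powr \<beta> * V * r ^ k)) \<noteq> top"
    using \<open>0 \<le> r\<close> by (intro ennreal_suminf_neq_top) (auto simp: V_def)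
  moreover have "(\<integral>\<^sup>+x. ennreal ((1 + (norm (x::'a))\<^sup>2) powr - \<beta>) \<partial>lborel) \<le> (\<integral>\<^sup>+x. (\<Sum>k. f k x) \<partial>lborel)"
    by (intro nn_integral_mono f_le)
  moreover have "\<dots> = (\<Sum>k. ennreal (4 powr \<beta> * V * r ^ k))"
    by (subst nn_integral_suminf) (auto simp: int_f)
  ultimately show ?thesis by (simp add: less_top le_less_trans)
qed

lemma powr_exp_bound:
  assumes "0 \<le> D" "0 < \<kappa>"
  obtains C :: real where "0 < C" "\<And>u. 0 \<le> u \<Longrightarrow> exp (- \<kappa> * u) \<le> C * (1 + u) powr - D"
proof
  \<comment> \<open>The point at which the tangent to the logarithm is taken. Its slope times
    \<open>D\<close> is \<open>\<kappa> * D / (D + 1)\<close>, below \<open>\<kappa>\<close>, and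
    the added 1 keeps \<open>k\<close> positive when \<open>D\<close> is 0.\<close>
  define k where "k = (D + 1) / \<kappa>"
  have k: "0 < k" using assms by (simp add: k_def)
  let ?C = "exp (\<kappa> + D * ln k)"
  show "0 < ?C" by simp
  fix u :: real assume u: "0 \<le> u"
  have "ln ((1 + u) / k) \<le> (1 + u) / k - 1"
    using u k by (intro ln_le_minus_one) auto
  then have "ln (1 + u) \<le> (1 + u) / k + ln k"
    using u k by (simp add: ln_div)
  then have "D * ln (1 + u) \<le> D * ((1 + u) / k + ln k)"
    using assms by (intro mult_left_mono)
  also have "D * ((1 + u) / k + ln k) = \<kappa> * (1 + u) * (D / (D + 1)) + D * ln k"
    using assms by (simp add: k_def field_simps)
  also have "\<dots> \<le> \<kappa> * (1 + u) * 1 + D * ln k"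
    using assms u by (intro add_right_mono mult_left_mono) auto
  finally have "- \<kappa> * u \<le> (\<kappa> + D * ln k) + - D * ln (1 + u)" by (simp add: algebra_simps)
  then have "exp (- \<kappa> * u) \<le> exp (\<kappa> + D * ln k) * exp (- D * ln (1 + u))"
    by (simp add: exp_add[symmetric])
  then show "exp (- \<kappa> * u) \<le> ?C * (1 + u) powr - D"
    using u by (simp add: powr_def)
qed

lemma nn_integral_exp_norm_finite:
  assumes "0 < \<kappa>"
  shows "(\<integral>\<^sup>+x. ennreal (exp (- \<kappa> * (norm (x::'a::euclidean_space))\<^sup>2)) \<partial>lborel) < \<infinity>"
proof -
  \<comment> \<open>The full dimension as exponent exceeds half the dimension, which makes the power
    integrable.\<close>
  obtain C where C: "0 < C" "\<And>u. 0 \<le> u \<Longrightarrow> exp (- \<kappa> * u) \<le> C * (1 + u) powr - real DIM('a)"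
    using powr_exp_bound[of "real DIM('a)" \<kappa>] assms by auto
  have "(\<integral>\<^sup>+x. ennreal (exp (- \<kappa> * (norm (x::'a))\<^sup>2)) \<partial>lborel)
      \<le> (\<integral>\<^sup>+x. ennreal C * ennreal ((1 + (norm (x::'a))\<^sup>2) powr - real DIM('a)) \<partial>lborel)"
    using C by (intro nn_integral_mono) (simp add: ennreal_mult'[symmetric] ennreal_leI)
  also have "\<dots> < \<infinity>"
    using nn_integral_powr_finite[where ?'a='a, of "real DIM('a)"]
    by (subst nn_integral_cmult) (auto simp: ennreal_mult_less_top)
  finally show ?thesis .
qed

section \<open>Norm estimates for the signal and the density\<close>

lemma norm_scalar_mult: "norm (c *s x) = norm c * norm (x :: complex ^ 'n)"
  by (simp add: norm_vec_def norm_mult L2_set_right_distrib)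

lemma norm_sum_mult_le: "norm (\<Sum>k\<in>UNIV. a $ k * b $ k) \<le> norm a * norm (b :: complex ^ 'n)"
proof -
  have "norm (\<Sum>k\<in>UNIV. a $ k * b $ k) \<le> (\<Sum>k\<in>UNIV. \<bar>norm (a $ k)\<bar> * \<bar>norm (b $ k)\<bar>)"
    by (rule order_trans[OF norm_sum]) (simp add: norm_mult)
  also have "\<dots> \<le> norm a * norm b"
    unfolding norm_vec_def by (rule L2_set_mult_ineq)
  finally show ?thesis .
qed

text \<open>Cauchy-Schwarz for a row of \<open>S\<close> against a row of \<open>P\<close>; unit
  rows make the bound independent of \<open>P\<close>.\<close>

lemma norm_signal_entry_le:
  assumes "norm (P $ j) = 1"
  shows "norm (signal P x S $ i $ j) \<le> norm (S $ i) * norm (x $ j)"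
  using norm_sum_mult_le[of "S $ i" "P $ j"] assms
  by (simp add: signal_nth norm_mult mult_right_mono)

lemma norm_signal_le:
  fixes P :: "complex ^ 'q ^ 'n"
  assumes "\<forall>i. norm (P $ i) = 1"
  shows "norm (signal P x S) \<le> norm x * norm S"
proof (rule power2_le_imp_le)
  have "(norm (signal P x S))\<^sup>2 \<le> (\<Sum>i\<in>UNIV. \<Sum>j\<in>UNIV. (norm (S $ i) * norm (x $ j))\<^sup>2)"
    unfolding norm_matrix_sq using assms
    by (intro sum_mono power_mono norm_signal_entry_le) auto
  also have "\<dots> = (\<Sum>i\<in>UNIV. (norm (S $ i))\<^sup>2) * (\<Sum>j\<in>UNIV. (norm (x $ j))\<^sup>2)"
    by (simp add: sum_product power_mult_distrib)
  also have "\<dots> = (norm x * norm S)\<^sup>2"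
    by (simp add: norm_vec_def L2_set_def sum_nonneg power_mult_distrib)
  finally show "(norm (signal P x S))\<^sup>2 \<le> (norm x * norm S)\<^sup>2" .
qed simp

text \<open>The normalizing powers of pi are at least 1 and may be dropped; only the growth in
  \<open>x\<close> and \<open>Y\<close> matters for the pre-log.\<close>

lemma channel_density_le_exp:
  "channel_density P (x, Y) \<le>
    (\<integral>\<^sup>+S. ennreal (exp (- ((norm S)\<^sup>2 + (norm (Y - signal P x S))\<^sup>2))) \<partial>lborel)"
  for P :: "complex ^ 'q ^ 'n" and Y :: "complex ^ 'n ^ 'm"
proof -
  have le: "gauss W \<le> exp (- (norm W)\<^sup>2)" for W :: "complex ^ 'a ^ 'b"
  proof -
    have "1 \<le> pi ^ (CARD('b) * CARD('a))" using pi_ge_two by (intro one_le_power) simp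
    then have "exp (- (norm W)\<^sup>2) * 1 \<le> exp (- (norm W)\<^sup>2) * pi ^ (CARD('b) * CARD('a))"
      by (intro mult_left_mono) auto
    then show ?thesis by (simp add: gauss_def divide_le_eq)
  qed
  have "gauss S * gauss (Y - signal P x S) \<le> exp (- (norm S)\<^sup>2) * exp (- (norm (Y - signal P x S))\<^sup>2)"
    for S :: "complex ^ 'q ^ 'm"
    by (intro mult_mono le less_imp_le[OF gauss_pos]) auto
  then show ?thesis
    unfolding channel_density_def prod.case
    by (intro nn_integral_mono ennreal_leI) (simp add: exp_add[symmetric] algebra_simps)
qed

section \<open>The bound \<open>1 - 1 / N\<close>\<close>

lemma signal_diff: "signal P (x' - x) S = signal P x' S - signal P x S"
  by (simp add: vec_eq_iff signal_nth right_diff_distrib)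

text \<open>Under division by \<open>c\<close> the preimage of the unit ball is the ball of radius
  \<open>norm c\<close>, hence inside the ball of radius 3. The Jacobian is thus bounded by a ratio
  of volumes that is uniform in \<open>c\<close>.\<close>

lemma nn_integral_lborel_divide_scalar_le:
  fixes f :: "complex ^ 'q ^ 'm \<Rightarrow> ennreal"
  assumes [measurable]: "f \<in> borel_measurable borel" and c: "1 \<le> norm c" "norm c \<le> 3"
  shows "(\<integral>\<^sup>+S. f (\<chi> i j. S $ i $ j / c) \<partial>lborel) * emeasure lborel (ball (0 :: complex ^ 'q ^ 'm) 1)
    \<le> emeasure lborel (ball (0 :: complex ^ 'q ^ 'm) 3) * (\<integral>\<^sup>+S. f S \<partial>lborel)"
proof -
  let ?L = "\<lambda>S. (\<chi> i j. S $ i $ j / c) :: complex ^ 'q ^ 'm"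
  have "c \<noteq> 0" using c by auto
  have nL: "norm (?L S) = norm S / norm c" for S
  proof (rule power2_eq_imp_eq)
    show "(norm (?L S))\<^sup>2 = (norm S / norm c)\<^sup>2"
      by (simp add: norm_matrix_sq norm_divide power_divide sum_divide_distrib)
  qed auto
  have lin: "linear ?L"
    by (rule linearI) (simp_all add: vec_eq_iff add_divide_distrib scaleR_conv_of_real)
  have surj: "surj ?L"
  proof (rule surjI)
    show "?L (\<chi> i j. S $ i $ j * c) = S" for S using \<open>c \<noteq> 0\<close> by (simp add: vec_eq_iff)
  qed
  have "emeasure lborel {S. norm (?L S) < 1} \<le> emeasure lborel (ball (0 :: complex ^ 'q ^ 'm) 3)"
    using \<open>c \<noteq> 0\<close> c by (intro emeasure_mono) (auto simp: nL divide_less_eq)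
  then show ?thesis
    unfolding nn_integral_lborel_linear[OF lin surj assms(1)]
    by (intro mult_right_mono) auto
qed

text \<open>The pairs \<open>(x, S)\<close> and \<open>(c *s x, S / c)\<close> give the same signal.
  Replacing \<open>c *s x\<close> by \<open>x'\<close> moves the signal by at most
  \<open>norm S\<close>, so the noise term at most becomes
  \<open>2 * (norm ?W)\<^sup>2 + 2 * (norm S)\<^sup>2\<close>; with the norm of the rescaled
  \<open>S\<close> the exponent grows at most threefold, which the division by 3 absorbs.\<close>

lemma signal_mixture_lower_bound:
  fixes P :: "complex ^ 'q ^ 'n" and Y :: "complex ^ 'n ^ 'm"
  assumes P: "\<forall>i. norm (P $ i) = 1" and c: "1 \<le> norm c" "norm c \<le> 3" and x': "norm (x' - c *s x) \<le> 1"
  shows "exp (- ((norm S)\<^sup>2 + (norm (Y - signal P x S))\<^sup>2))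
    \<le> exp (- ((norm (\<chi> i j. S $ i $ j / c))\<^sup>2 + (norm (Y - signal P x' (\<chi> i j. S $ i $ j / c)))\<^sup>2) / 3)"
proof -
  let ?S = "(\<chi> i j. S $ i $ j / c) :: complex ^ 'q ^ 'm"
  let ?W = "Y - signal P x S"
  have "c \<noteq> 0" using c by auto
  have sig: "signal P (c *s x) ?S = signal P x S"
    using \<open>c \<noteq> 0\<close> by (simp add: vec_eq_iff signal_nth sum_divide_distrib[symmetric])
  have nS: "norm ?S \<le> norm S"
  proof (rule power2_le_imp_le)
    show "(norm ?S)\<^sup>2 \<le> (norm S)\<^sup>2"
      unfolding norm_matrix_sq using c
      by (intro sum_mono power_mono) (auto simp: norm_divide divide_le_eq mult_left_le mult_le_cancel_left1 intro: order_trans[of _ "_ * 1"])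
  qed simp
  have "Y - signal P x' ?S = ?W - signal P (x' - c *s x) ?S"
    by (simp add: signal_diff sig)
  then have "norm (Y - signal P x' ?S) \<le> norm ?W + norm (signal P (x' - c *s x) ?S)"
    using norm_triangle_ineq4 by metis
  also have "\<dots> \<le> norm ?W + norm S"
  proof -
    have "norm (signal P (x' - c *s x) ?S) \<le> norm (x' - c *s x) * norm ?S" by (rule norm_signal_le[OF P])
    also have "\<dots> \<le> 1 * norm S" using x' nS by (intro mult_mono) auto
    finally show ?thesis by simp
  qed
  finally have "(norm (Y - signal P x' ?S))\<^sup>2 \<le> (norm ?W + norm S)\<^sup>2" by (intro power_mono) auto
  also have "\<dots> \<le> 2 * (norm ?W)\<^sup>2 + 2 * (norm S)\<^sup>2"
    using zero_le_power2[of "norm ?W - norm S"] by (simp add: power2_eq_square algebra_simps)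
  finally have "(norm (Y - signal P x' ?S))\<^sup>2 \<le> 2 * (norm ?W)\<^sup>2 + 2 * (norm S)\<^sup>2" .
  moreover have aux: "a \<le> 2 * w + 2 * s \<Longrightarrow> b \<le> s \<Longrightarrow> 0 \<le> w \<Longrightarrow> b + a \<le> 3 * (s + w)" for a b s w :: real
    by simp
  moreover have "(norm ?S)\<^sup>2 \<le> (norm S)\<^sup>2" using nS by (intro power_mono) auto
  ultimately have "(norm ?S)\<^sup>2 + (norm (Y - signal P x' ?S))\<^sup>2 \<le> 3 * ((norm S)\<^sup>2 + (norm ?W)\<^sup>2)"
    using zero_le_power2[of "norm ?W"] by (intro aux)
  then show ?thesis by simp
qed

text \<open>Two admissible scalars satisfy \<open>norm (c0 - c) * norm x < 2\<close>, so for large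
  \<open>x\<close> they fill at most a disc of radius \<open>2 / norm x\<close>; for
  \<open>norm x \<le> 1\<close> the area pi of the whole disc is good enough. The constant 8 covers
  both cases.\<close>

lemma emeasure_scalars_near_le:
  fixes x x' :: "complex ^ 'n"
  shows "emeasure lborel {c \<in> ball 2 1. norm (x' - c *s x) < 1} \<le> ennreal (8 * pi / (1 + (norm x)\<^sup>2))"
    (is "emeasure lborel ?A \<le> _")
proof (cases "norm x \<le> 1")
  case True
  have "emeasure lborel ?A \<le> emeasure lborel (ball (2::complex) 1)"
    by (intro emeasure_mono) auto
  also have "\<dots> = ennreal pi" by (simp add: emeasure_ball unit_ball_vol_2)
  also have "\<dots> \<le> ennreal (8 * pi / (1 + (norm x)\<^sup>2))"
  proof (rule ennreal_leI)
    have "(norm x)\<^sup>2 \<le> 1" using True by (simp add: power_le_one)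
    then have "pi * (1 + (norm x)\<^sup>2) \<le> pi * 8" by (intro mult_left_mono) auto
    then show "pi \<le> 8 * pi / (1 + (norm x)\<^sup>2)"
      using add_pos_nonneg[of 1 "(norm x)\<^sup>2"] by (simp add: pos_le_divide_eq)
  qed
  finally show ?thesis .
next
  case False
  show ?thesis
  proof (cases "?A = {}")
    case True
    then show ?thesis by (simp only: emeasure_empty zero_le)
  next
    case False
    then obtain c0 where c0: "norm (x' - c0 *s x) < 1" by auto
    have "?A \<subseteq> ball c0 (2 / norm x)"
    proof
      fix c assume "c \<in> ?A"
      then have "norm ((x' - c *s x) - (x' - c0 *s x)) < 2"
        using c0 norm_triangle_ineq4[of "x' - c *s x" "x' - c0 *s x"] by simp
      moreover have "(x' - c *s x) - (x' - c0 *s x) = (c0 - c) *s x"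
        by (simp add: vec_eq_iff left_diff_distrib)
      ultimately have "norm (c0 - c) * norm x < 2" by (simp only: norm_scalar_mult)
      then show "c \<in> ball c0 (2 / norm x)"
        using \<open>\<not> norm x \<le> 1\<close> by (auto simp: dist_norm less_divide_eq)
    qed
    then have "emeasure lborel ?A \<le> emeasure lborel (ball c0 (2 / norm x))"
      by (intro emeasure_mono) auto
    also have "\<dots> = ennreal (pi * (2 / norm x)\<^sup>2)" by (simp add: emeasure_ball unit_ball_vol_2)
    also have "\<dots> \<le> ennreal (8 * pi / (1 + (norm x)\<^sup>2))"
    proof (rule ennreal_leI)
      have "1 < (norm x)\<^sup>2" using \<open>\<not> norm x \<le> 1\<close> by simp
      then have "1 + (norm x)\<^sup>2 \<le> 2 * (norm x)\<^sup>2" by simp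
      then have "8 * pi / (2 * (norm x)\<^sup>2) \<le> 8 * pi / (1 + (norm x)\<^sup>2)"
        by (intro divide_left_mono) (auto intro!: mult_pos_pos add_pos_nonneg)
      then show "pi * (2 / norm x)\<^sup>2 \<le> 8 * pi / (1 + (norm x)\<^sup>2)"
        by (simp add: power_divide mult.commute)
    qed
    finally show ?thesis .
  qed
qed

text \<open>The mixture weight costs the exponent \<open>CARD('n) + \<epsilon>\<close>, and the
  volume of the matching \<open>x'\<close> gives back 1.\<close>

lemma channel_density_le_mixture:
  fixes P :: "complex ^ 'q ^ 'n"
  assumes P: "\<forall>i. norm (P $ i) = 1" and "0 < \<epsilon>"
  obtains q :: "complex ^ 'n ^ 'm \<Rightarrow> ennreal"
  where "q \<in> borel_measurable borel" "(\<integral>\<^sup>+Y. q Y \<partial>lborel) < \<infinity>"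
    "\<And>x Y. channel_density P (x, Y) \<le> ennreal ((1 + (norm x)\<^sup>2) powr (real CARD('n) - 1 + \<epsilon>)) * q Y"
proof -
  \<comment> \<open>Just above half the real dimension of the input space, so that the weight
    \<open>\<nu>\<close> is integrable.\<close>
  define B where "B = real CARD('n) + \<epsilon>"
  define \<nu> where "\<nu> x = ennreal ((1 + (norm x)\<^sup>2) powr - B)" for x :: "complex ^ 'n"
  define F where "F x S Y = ennreal (exp (- ((norm S)\<^sup>2 + (norm (Y - signal P x S))\<^sup>2) / 3))"
    for x and S :: "complex ^ 'q ^ 'm" and Y
  define G where "G x Y = \<nu> x * (\<integral>\<^sup>+S. F x S Y \<partial>lborel)" for x Y
  define q where "q Y = (\<integral>\<^sup>+x. G x Y \<partial>lborel)" for Y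
  define D where "D x Y = (\<integral>\<^sup>+S. ennreal (exp (- ((norm (S :: complex ^ 'q ^ 'm))\<^sup>2 + (norm (Y - signal P x S))\<^sup>2))) \<partial>lborel)"
    for x Y
  \<comment> \<open>Integrating \<open>T\<close> over \<open>x'\<close> by Fubini is what measures the set of \<open>x'\<close> close to some multiple of \<open>x\<close>.\<close>
  define T where "T x x' = emeasure lborel {c \<in> ball 2 1. norm (x' - c *s x) < 1}" for x x' :: "complex ^ 'n"
  have [measurable]: "\<nu> \<in> borel_measurable borel" unfolding \<nu>_def by measurable
  have Fm: "(\<lambda>z. F (f z) (g z) (h z)) \<in> borel_measurable M"
    if [measurable]: "f \<in> borel_measurable M" "g \<in> borel_measurable M" "h \<in> borel_measurable M" for f g h and M :: "'z measure"
    unfolding F_def by measurable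
  note Fm[measurable (raw)]
  have [measurable]: "(\<lambda>(Y, x). G x Y) \<in> borel_measurable (borel \<Otimes>\<^sub>M borel)"
    unfolding G_def by measurable
  have qm: "q \<in> borel_measurable borel" unfolding q_def by measurable
  \<comment> \<open>After Tonelli the shift by the signal disappears from the integral over
    \<open>Y\<close>, and three independent finite integrals over \<open>x\<close>, \<open>S\<close>
    and \<open>Y\<close> remain.\<close>
  have "(\<integral>\<^sup>+Y. q Y \<partial>lborel) = (\<integral>\<^sup>+x. (\<integral>\<^sup>+Y. G x Y \<partial>lborel) \<partial>lborel)"
    unfolding q_def by (rule lborel_pair.Fubini') measurable
  also have "\<dots> = (\<integral>\<^sup>+x. \<nu> x * (\<integral>\<^sup>+Y. (\<integral>\<^sup>+S. F x S Y \<partial>lborel) \<partial>lborel) \<partial>lborel)"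
    unfolding G_def by (intro nn_integral_cong nn_integral_cmult) measurable
  also have "\<dots> = (\<integral>\<^sup>+x. \<nu> x * (\<integral>\<^sup>+S. (\<integral>\<^sup>+Y. F x S Y \<partial>lborel) \<partial>lborel) \<partial>lborel)"
    by (intro nn_integral_cong arg_cong2[where f="(*)"] refl lborel_pair.Fubini') measurable
  also have "\<dots> = (\<integral>\<^sup>+x. \<nu> x * (\<integral>\<^sup>+S. ennreal (exp (- (1/3) * (norm (S :: complex ^ 'q ^ 'm))\<^sup>2)) *
      (\<integral>\<^sup>+Y. ennreal (exp (- (1/3) * (norm (Y :: complex ^ 'n ^ 'm))\<^sup>2)) \<partial>lborel) \<partial>lborel) \<partial>lborel)"
  proof (intro nn_integral_cong arg_cong2[where f="(*)"] refl)
    fix x and S :: "complex ^ 'q ^ 'm"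
    have "F x S (signal P x S + Y) = ennreal (exp (- (1/3) * (norm S)\<^sup>2)) * ennreal (exp (- (1/3) * (norm Y)\<^sup>2))" for Y
      by (simp add: F_def ennreal_mult'[symmetric] exp_add[symmetric] field_simps)
    then show "(\<integral>\<^sup>+Y. F x S Y \<partial>lborel) = ennreal (exp (- (1/3) * (norm S)\<^sup>2)) *
      (\<integral>\<^sup>+Y. ennreal (exp (- (1/3) * (norm (Y :: complex ^ 'n ^ 'm))\<^sup>2)) \<partial>lborel)"
      by (subst nn_integral_lborel_translate[of "F x S" "signal P x S", symmetric])
        (simp_all add: nn_integral_cmult)
  qed
  also have "\<dots> < \<infinity>"
    using nn_integral_exp_norm_finite[where ?'a="complex ^ 'q ^ 'm", of "1/3"]
      nn_integral_exp_norm_finite[where ?'a="complex ^ 'n ^ 'm", of "1/3"]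
      nn_integral_powr_finite[where ?'a="complex ^ 'n", of B] \<open>0 < \<epsilon>\<close>
    by (simp add: nn_integral_multc ennreal_mult_less_top B_def \<nu>_def)
  finally have qfin: "(\<integral>\<^sup>+Y. q Y \<partial>lborel) < \<infinity>" .
  define v1 where "v1 = emeasure lborel (ball (0 :: complex ^ 'q ^ 'm) 1)"
  define v3 where "v3 = emeasure lborel (ball (0 :: complex ^ 'q ^ 'm) 3)"
  define vx where "vx = emeasure lborel (ball (0 :: complex ^ 'n) 1) * ennreal pi"
  have msr[measurable]: "{(x', c). c \<in> ball 2 1 \<and> norm (x' - c *s x) < 1} \<in> sets (borel \<Otimes>\<^sub>M borel)" for x :: "complex ^ 'n"
  proof -
    have "(\<lambda>z. fst z - snd z *s x) \<in> borel_measurable (borel \<Otimes>\<^sub>M borel)"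
      unfolding borel_prod vector_scalar_mult_def
      by (intro borel_measurable_continuous_onI continuous_intros)
    then have [measurable]: "(\<lambda>z. norm (fst z - snd z *s x)) \<in> borel_measurable (borel \<Otimes>\<^sub>M borel)"
      by measurable
    have "{z \<in> space (borel \<Otimes>\<^sub>M borel). dist 2 (snd z) < 1 \<and> norm (fst z - snd z *s x) < 1} \<in> sets (borel \<Otimes>\<^sub>M borel)"
      by measurable
    then show ?thesis by (simp add: case_prod_unfold space_pair_measure)
  qed
  have T_eq: "T x x' = (\<integral>\<^sup>+c. indicator {(x', c). c \<in> ball 2 1 \<and> norm (x' - c *s x) < 1} (x', c) \<partial>lborel)" for x x'
  proof -
    have "indicator {(x', c). c \<in> ball 2 1 \<and> norm (x' - c *s x) < 1} (x', c)
      = (indicator {c \<in> ball 2 1. norm (x' - c *s x) < 1} c :: ennreal)" for c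
      by (simp add: indicator_def)
    moreover have "{c \<in> ball 2 1. norm (x' - c *s x) < 1} \<in> sets borel"
      using sets_Pair1[OF msr[of x], of x'] by (simp add: vimage_def conj_commute)
    ultimately show ?thesis by (simp add: T_def)
  qed
  have Tm[measurable]: "T x \<in> borel_measurable borel" for x
    unfolding T_eq by measurable
  \<comment> \<open>For each \<open>c\<close> in the disc, \<open>x'\<close> runs through the unit
    ball around \<open>c *s x\<close>, whose volume depends neither on \<open>c\<close> nor on
    \<open>x\<close>; the disc contributes its area pi.\<close>
  have T_int: "(\<integral>\<^sup>+x'. T x x' \<partial>lborel) = vx" for x
  proof -
    let ?g = "\<lambda>x' c. indicator {(x', c). c \<in> ball 2 1 \<and> norm (x' - c *s x) < 1} (x', c) :: ennreal"
    have "(\<integral>\<^sup>+x'. T x x' \<partial>lborel) = (\<integral>\<^sup>+x'. (\<integral>\<^sup>+c. ?g x' c \<partial>lborel) \<partial>lborel)"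
      by (simp add: T_eq)
    also have "\<dots> = (\<integral>\<^sup>+c. (\<integral>\<^sup>+x'. ?g x' c \<partial>lborel) \<partial>lborel)"
      by (rule lborel_pair.Fubini') measurable
    also have "\<dots> = (\<integral>\<^sup>+c. emeasure lborel (ball (0 :: complex ^ 'n) 1) * indicator (ball (2::complex) 1) c \<partial>lborel)"
    proof (rule nn_integral_cong)
      fix c :: complex
      have "?g x' c = indicator (ball 2 1) c * indicator (ball (c *s x) 1) x'" for x'
        by (simp add: indicator_def dist_norm norm_minus_commute)
      then show "(\<integral>\<^sup>+x'. ?g x' c \<partial>lborel) = emeasure lborel (ball (0 :: complex ^ 'n) 1) * indicator (ball (2::complex) 1) c"
        using nn_integral_cmult_indicator[of "ball (c *s x) 1" lborel "indicator (ball 2 1) c"]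
        by (simp only: emeasure_ball zero_le_one) (simp add: mult.commute)
    qed
    also have "\<dots> = vx"
      by (subst nn_integral_cmult_indicator) (auto simp: vx_def emeasure_ball unit_ball_vol_2)
    finally show ?thesis .
  qed
  \<comment> \<open>Without a suitable \<open>c\<close> the factor \<open>T x x'\<close> is 0.
    Otherwise one such \<open>c\<close> allows comparing the weights at \<open>x\<close> and
    \<open>x'\<close> and the integrals over \<open>S\<close>, and the area bound controls
    \<open>T x x'\<close>.\<close>
  have key: "v1 * (ennreal (18 powr - B * (1 + (norm x)\<^sup>2) powr - B) * D x Y) * T x x'
      \<le> v3 * G x' Y * ennreal (8 * pi / (1 + (norm x)\<^sup>2))" for x x' Y
  proof (cases "\<exists>c \<in> ball 2 1. norm (x' - c *s x) < 1")
    case True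
    then obtain c where c: "c \<in> ball 2 1" and x': "norm (x' - c *s x) < 1" by blast
    have nc: "1 \<le> norm c" "norm c \<le> 3"
      using c norm_triangle_ineq2[of 2 c] norm_triangle_ineq2[of c 2] by (auto simp: dist_norm norm_minus_commute)
    have "norm x' \<le> norm (x' - c *s x) + norm (c *s x)" 
      using norm_triangle_ineq[of "x' - c *s x" "c *s x"] by simp
    also have "\<dots> \<le> 1 + 3 * norm x"
      using x' nc by (simp only: norm_scalar_mult) (intro add_mono mult_right_mono, auto)
    finally have "(norm x')\<^sup>2 \<le> (1 + 3 * norm x)\<^sup>2" by (intro power_mono) auto
    \<comment> \<open>The constant 17 is generous; it is chosen so that adding 1 lets the factor 18
      be taken out.\<close>
    also have "\<dots> \<le> 17 + 18 * (norm x)\<^sup>2"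
      using zero_le_power2[of "1 - 3 * norm x"] by (simp add: power2_eq_square algebra_simps)
    finally have "1 + (norm x')\<^sup>2 \<le> 18 * (1 + (norm x)\<^sup>2)" by simp
    then have "(18 * (1 + (norm x)\<^sup>2)) powr - B \<le> (1 + (norm x')\<^sup>2) powr - B"
      using \<open>0 < \<epsilon>\<close> by (intro powr_mono2') (auto simp: B_def intro: add_pos_nonneg)
    then have nu: "ennreal (18 powr - B * (1 + (norm x)\<^sup>2) powr - B) \<le> \<nu> x'"
      unfolding \<nu>_def by (subst powr_mult[symmetric]) (auto intro: ennreal_leI)
    have "v1 * D x Y \<le> v1 * (\<integral>\<^sup>+S. F x' (\<chi> i j. S $ i $ j / c) Y \<partial>lborel)"
      unfolding D_def F_def using signal_mixture_lower_bound[OF P nc less_imp_le[OF x']]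
      by (intro mult_left_mono nn_integral_mono ennreal_leI) auto
    also have "\<dots> \<le> v3 * (\<integral>\<^sup>+S. F x' S Y \<partial>lborel)"
      using nn_integral_lborel_divide_scalar_le[of "\<lambda>S. F x' S Y" c] nc
      by (simp add: v1_def v3_def mult.commute)
    finally have "ennreal (18 powr - B * (1 + (norm x)\<^sup>2) powr - B) * (v1 * D x Y) \<le> \<nu> x' * (v3 * (\<integral>\<^sup>+S. F x' S Y \<partial>lborel))"
      by (rule mult_mono[OF nu]) auto
    then have "v1 * (ennreal (18 powr - B * (1 + (norm x)\<^sup>2) powr - B) * D x Y) \<le> v3 * G x' Y"
      by (simp add: G_def ac_simps)
    then show ?thesis
      unfolding T_def by (rule mult_mono[OF _ emeasure_scalars_near_le]) auto
  next
    case False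
    then have "{c \<in> ball 2 1. norm (x' - c *s x) < 1} = {}" by blast
    then show ?thesis by (simp only: T_def emeasure_empty mult_zero_right zero_le)
  qed
  \<comment> \<open>Integrating \<open>key\<close> over \<open>x'\<close>: the left side yields the
    constant \<open>vx\<close>, the right side yields \<open>q Y\<close> with a gain of order
    \<open>1 / (1 + (norm x)\<^sup>2)\<close>.\<close>
  have ineq: "v1 * (ennreal (18 powr - B * (1 + (norm x)\<^sup>2) powr - B) * D x Y) * vx
      \<le> v3 * q Y * ennreal (8 * pi / (1 + (norm x)\<^sup>2))" for x Y
  proof -
    have "v1 * (ennreal (18 powr - B * (1 + (norm x)\<^sup>2) powr - B) * D x Y) * vx
      = (\<integral>\<^sup>+x'. v1 * (ennreal (18 powr - B * (1 + (norm x)\<^sup>2) powr - B) * D x Y) * T x x' \<partial>lborel)"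
      by (simp add: nn_integral_cmult T_int)
    also have "\<dots> \<le> (\<integral>\<^sup>+x'. v3 * G x' Y * ennreal (8 * pi / (1 + (norm x)\<^sup>2)) \<partial>lborel)"
      by (intro nn_integral_mono key)
    also have "\<dots> = v3 * q Y * ennreal (8 * pi / (1 + (norm x)\<^sup>2))"
      unfolding q_def by (simp add: nn_integral_multc nn_integral_cmult)
    finally show ?thesis .
  qed
  obtain r1 r3 rx where r: "v1 = ennreal r1" "v3 = ennreal r3" "vx = ennreal rx" "0 < r1" "0 < r3" "0 < rx"
  proof
    let ?m = "unit_ball_vol (real DIM(complex ^ 'q ^ 'm))" and ?n = "unit_ball_vol (real DIM(complex ^ 'n))"
    show "v1 = ennreal ?m" by (simp add: v1_def emeasure_ball)
    show "v3 = ennreal (?m * 3 ^ DIM(complex ^ 'q ^ 'm))" unfolding v3_def by (subst emeasure_ball) simp_all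
    show "vx = ennreal (?n * pi)" by (simp add: vx_def emeasure_ball ennreal_mult')
  qed simp_all
  define K where "K = r3 * 8 * pi / (r1 * 18 powr - B * rx)"
  show thesis
  proof (rule that[of "\<lambda>Y. ennreal K * q Y"])
    show "(\<lambda>Y. ennreal K * q Y) \<in> borel_measurable borel" using qm by measurable
    show "(\<integral>\<^sup>+Y. ennreal K * q Y \<partial>lborel) < \<infinity>"
      using qm qfin by (simp add: nn_integral_cmult ennreal_mult_less_top)
    fix x :: "complex ^ 'n" and Y :: "complex ^ 'n ^ 'm"
    define a where "a = 1 + (norm x)\<^sup>2"
    have "0 < a" by (auto simp: a_def intro: add_pos_nonneg)
    have "channel_density P (x, Y) \<le> D x Y"
      unfolding D_def by (rule channel_density_le_exp)
    also have "D x Y \<le> ennreal (a powr (real CARD('n) - 1 + \<epsilon>)) * (ennreal K * q Y)"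
    proof -
      \<comment> \<open>The whole factor in front of \<open>D x Y\<close> in \<open>ineq\<close>.
        Dividing by it leaves \<open>a powr B / a\<close>, the weight loss against the volume
        gain.\<close>
      define k where "k = r1 * 18 powr - B * rx * a powr - B"
      have "0 < k" using r \<open>0 < a\<close> by (simp add: k_def)
      have "ennreal k * D x Y = v1 * (ennreal (18 powr - B * a powr - B) * D x Y) * vx"
        unfolding r k_def using r(4-6) by (simp add: ennreal_mult' ac_simps)
      also have "\<dots> \<le> v3 * q Y * ennreal (8 * pi / a)"
        using ineq[of x Y] by (simp add: a_def)
      also have "\<dots> = ennreal (r3 * 8 * pi / a) * q Y"
      proof -
        have "r3 * 8 * pi / a = r3 * (8 * pi / a)" by simp
        then show ?thesis unfolding r using r(5) by (simp only: ennreal_mult' less_imp_le ac_simps)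
      qed
      finally have "ennreal (1 / k) * (ennreal k * D x Y) \<le> ennreal (1 / k) * (ennreal (r3 * 8 * pi / a) * q Y)"
        by (intro mult_left_mono) auto
      then have "D x Y \<le> ennreal (1 / k * (r3 * 8 * pi / a)) * q Y"
        using \<open>0 < k\<close> r(5) \<open>0 < a\<close> by (simp add: mult.assoc[symmetric] ennreal_mult'[symmetric])
      also have "1 / k * (r3 * 8 * pi / a) = K * (a powr B / a)"
        by (simp add: k_def K_def powr_minus field_simps)
      also have "a powr B / a = a powr (real CARD('n) - 1 + \<epsilon>)"
        using \<open>0 < a\<close> by (simp add: B_def powr_diff powr_add)
      also have "ennreal (K * a powr (real CARD('n) - 1 + \<epsilon>)) * q Y = ennreal (a powr (real CARD('n) - 1 + \<epsilon>)) * (ennreal K * q Y)"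
      proof -
        have "0 \<le> K" using r(4-6) by (simp add: K_def)
        then show ?thesis by (subst ennreal_mult') (simp_all only: ac_simps)
      qed
      finally show ?thesis .
    qed
    finally show "channel_density P (x, Y) \<le> ennreal ((1 + (norm x)\<^sup>2) powr (real CARD('n) - 1 + \<epsilon>)) * (ennreal K * q Y)"
      by (simp add: a_def)
  qed
qed

section \<open>The bound \<open>M (1 - Q / N)\<close>\<close>

text \<open>A basis of the row space can be taken among the rows. Having \<open>CARD('q)\<close>
  elements, it spans the whole space, so the square matrix formed from it is invertible.\<close>

lemma independent_rows_of_full_rank:
  fixes P :: "'a::field ^ 'q ^ 'n"
  assumes "rank P = CARD('q)"
  obtains \<sigma> :: "'q \<Rightarrow> 'n" where "inj \<sigma>" "invertible (\<chi> i. P $ \<sigma> i)"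
proof -
  obtain B where B: "B \<subseteq> rows P" "vec.independent B" "rows P \<subseteq> vec.span B" "card B = CARD('q)"
    using vec.basis_exists[of "rows P"] assms by (metis row_rank_def_gen)
  have "finite B" using B(4) by (metis card.infinite zero_less_card_finite less_irrefl)
  then obtain f :: "'q \<Rightarrow> 'a ^ 'q" where f: "bij_betw f UNIV B"
    using B(4) finite_same_card_bij[of "UNIV :: 'q set" B] by auto
  have "\<exists>j. P $ j = f i" for i
  proof -
    have "f i \<in> rows P" using B(1) f by (auto simp: bij_betw_def)
    then show ?thesis by (auto simp: rows_def row_def vec_eq_iff)
  qed
  then obtain \<sigma> where \<sigma>: "\<And>i. P $ \<sigma> i = f i" by metis
  let ?A = "\<chi> i. P $ \<sigma> i"
  have "rows ?A = B"
    using f by (auto simp: rows_def row_def \<sigma> bij_betw_def vec_eq_iff[symmetric] vec_nth_inverse)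
  moreover have "UNIV \<subseteq> vec.span B"
    using B(2,4) by (intro vec.card_ge_dim_independent) (auto simp: vec_dim_card card_cart_basis)
  ultimately have "\<exists>A'. A' ** ?A = mat 1"
    unfolding matrix_left_invertible_span_rows_gen by auto
  then have "invertible ?A"
    unfolding invertible_def using matrix_left_right_inverse by blast
  moreover have "inj \<sigma>"
  proof (rule injI)
    fix i j assume "\<sigma> i = \<sigma> j"
    then have "f i = f j" using \<sigma> by metis
    then show "i = j" using f by (auto simp: bij_betw_def inj_on_def)
  qed
  ultimately show thesis by (rule that[rotated])
qed

text \<open>Completing the square in \<open>t\<close>; the remainder
  \<open>(norm y)\<^sup>2 / (1 + (norm x)\<^sup>2)\<close> is dropped. With
  \<open>w = y - t * x\<close> the claim becomes Cauchy-Schwarz for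
  \<open>t - cnj x * w\<close>.\<close>

lemma complete_square_le:
  fixes t x y :: complex
  shows "(1 + (norm x)\<^sup>2) * (norm (t - y * cnj x / complex_of_real (1 + (norm x)\<^sup>2)))\<^sup>2 \<le> (norm t)\<^sup>2 + (norm (y - t * x))\<^sup>2"
proof -
  define a where "a = 1 + (norm x)\<^sup>2"
  define w where "w = y - t * x"
  have a: "0 < a" by (auto simp: a_def intro: add_pos_nonneg)
  have "of_real a * t - y * cnj x = t - cnj x * w"
  proof -
    have "(complex_of_real (norm x))\<^sup>2 = x * cnj x" by (metis complex_norm_square of_real_power)
    then show ?thesis by (simp add: a_def w_def algebra_simps)
  qed
  then have "t - y * cnj x / of_real a = (t - cnj x * w) / of_real a"
    using a by (simp add: field_simps)
  then have "a * (norm (t - y * cnj x / of_real a))\<^sup>2 = (norm (t - cnj x * w))\<^sup>2 / a"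
    using a by (simp add: norm_divide power_divide power2_eq_square)
  also have "\<dots> \<le> (norm t)\<^sup>2 + (norm w)\<^sup>2"
  proof -
    have "norm (t - cnj x * w) \<le> norm t + norm x * norm w"
      using norm_triangle_ineq4[of t "cnj x * w"] by (simp add: norm_mult)
    then have "(norm (t - cnj x * w))\<^sup>2 \<le> (norm t + norm x * norm w)\<^sup>2" by (intro power_mono) auto
    also have "\<dots> \<le> a * ((norm t)\<^sup>2 + (norm w)\<^sup>2)"
      using zero_le_power2[of "norm w - norm x * norm t"] by (simp add: a_def power2_eq_square algebra_simps)
    finally show ?thesis using a by (simp add: divide_le_eq mult.commute)
  qed
  finally show ?thesis by (simp add: a_def w_def)
qed

text \<open>Scaling by \<open>sqrt a\<close> in two real dimensions produces the factor
  \<open>1 / a\<close>, the source of the gain at each selected index.\<close>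

lemma nn_integral_complex_gaussian:
  obtains g :: real where "0 \<le> g"
    "\<And>a t. 0 < a \<Longrightarrow> (\<integral>\<^sup>+z. ennreal (exp (- a * (norm (z - t :: complex))\<^sup>2)) \<partial>lborel) = ennreal (g / a)"
proof -
  define I where "I = (\<integral>\<^sup>+z. ennreal (exp (- 1 * (norm (z::complex))\<^sup>2)) \<partial>lborel)"
  have "I < \<infinity>" unfolding I_def by (rule nn_integral_exp_norm_finite) simp
  then obtain g where g: "I = ennreal g" "0 \<le> g" by (cases I) auto
  have 1: "(\<integral>\<^sup>+z. ennreal (exp (- a * (norm (z - t))\<^sup>2)) \<partial>lborel) = ennreal (g / a)"
    if a: "0 < a" for a and t :: complex
  proof -
    have "I = ennreal a * (\<integral>\<^sup>+z. ennreal (exp (- a * (norm (z::complex))\<^sup>2)) \<partial>lborel)"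
      unfolding I_def using a
      by (subst nn_integral_lborel_scaleR[where c="sqrt a"]) (auto simp: power_mult_distrib)
    moreover have "(\<integral>\<^sup>+z. ennreal (exp (- a * (norm (z - t))\<^sup>2)) \<partial>lborel) = (\<integral>\<^sup>+z. ennreal (exp (- a * (norm (z::complex))\<^sup>2)) \<partial>lborel)"
      using nn_integral_lborel_translate[of "\<lambda>z. ennreal (exp (- a * (norm (z - t))\<^sup>2))" t] by simp
    moreover have "ennreal (1 / a) * (ennreal a * J) = J" for J
      using a by (simp add: mult.assoc[symmetric] ennreal_mult'[symmetric])
    ultimately have "(\<integral>\<^sup>+z. ennreal (exp (- a * (norm (z - t))\<^sup>2)) \<partial>lborel) = ennreal (1 / a) * ennreal g"
      using g by metis
    then show ?thesis using a g by (simp add: ennreal_mult'[symmetric])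
  qed
  show thesis using g(2) 1 by (rule that)
qed

text \<open>The substitution \<open>T = L S\<close> makes the entries of \<open>T\<close> the fading
  coefficients at the selected columns. Keeping only these columns of \<open>Y\<close> and
  completing the square in each entry bounds the integrand by a product of scalar Gaussians of
  precision proportional to \<open>1 + (norm (x $ \<sigma> i))\<^sup>2\<close>.\<close>

lemma channel_exp_integral_le:
  fixes P :: "complex ^ 'q ^ 'n" and \<sigma> :: "'q \<Rightarrow> 'n"
  assumes P: "\<forall>i. norm (P $ i) = 1" and "inj \<sigma>" "invertible (\<chi> i. P $ \<sigma> i)"
  obtains C :: real where "0 < C"
    "\<And>x (Y :: complex ^ 'n ^ 'm). (\<integral>\<^sup>+S. ennreal (exp (- (1/2) * ((norm S)\<^sup>2 + (norm (Y - signal P x S))\<^sup>2))) \<partial>lborel)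
      \<le> ennreal (C * (\<Prod>i\<in>UNIV. 1 / (1 + (norm (x $ \<sigma> i))\<^sup>2)) ^ CARD('m))"
proof -
  let ?A = "(\<chi> i. P $ \<sigma> i) :: complex ^ 'q ^ 'q"
  define L where "L = (\<lambda>S :: complex ^ 'q ^ 'm. S ** transpose ?A)"
  have L_nth: "L S $ m $ i = (\<Sum>k\<in>UNIV. S $ m $ k * P $ \<sigma> i $ k)" for S m i
    by (simp add: L_def matrix_matrix_mult_def transpose_def)
  have lin: "linear L"
    by (rule linearI) (simp_all add: vec_eq_iff L_nth sum.distrib distrib_right scaleR_right_distrib scaleR_sum_right)
  have surj: "surj L"
  proof -
    obtain A' where "?A ** A' = mat 1" using assms(3) by (auto simp: invertible_def)
    then have "transpose (?A ** A') = mat 1" by (simp add: transpose_mat)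
    then obtain B where B: "B ** transpose ?A = mat 1" by (auto simp: matrix_transpose_mul)
    show ?thesis
    proof (rule surjI)
      show "L (T ** B) = T" for T
        unfolding L_def by (simp add: matrix_mul_assoc[symmetric] B)
    qed
  qed
  define v where "v = emeasure lborel {S. norm (L S) < 1}"
  \<comment> \<open>An injective linear map is bounded below, so the preimage of the unit ball is
    bounded and the Jacobian factor \<open>v\<close> is finite.\<close>
  have "bounded {S. norm (L S) < 1}"
  proof -
    have "inj L" using lin surj by (rule linear_surjective_imp_injective) simp
    then obtain k where k: "0 < k" "\<And>S. k * norm S \<le> norm (L S)"
      using linear_inj_bounded_below_pos[OF lin] by (metis mult.commute)
    show ?thesis
      unfolding bounded_iff using k by (intro exI[of _ "1 / k"]) (smt (verit) mem_Collect_eq mult.commute pos_le_divide_eq)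
  qed
  then have "v < \<infinity>" unfolding v_def by (rule emeasure_bounded_finite)
  then obtain r where r: "v = ennreal r" "0 \<le> r" by (cases v) auto
  obtain r1 where r1: "emeasure lborel (ball (0 :: complex ^ 'q ^ 'm) 1) = ennreal r1" "0 < r1"
  proof
    show "emeasure lborel (ball (0 :: complex ^ 'q ^ 'm) 1) = ennreal (unit_ball_vol (real DIM(complex ^ 'q ^ 'm)))"
      by (simp add: emeasure_ball)
  qed simp
  obtain g where g: "0 \<le> g"
    "\<And>a t. 0 < a \<Longrightarrow> (\<integral>\<^sup>+z. ennreal (exp (- a * (norm (z - t :: complex))\<^sup>2)) \<partial>lborel) = ennreal (g / a)"
    using nn_integral_complex_gaussian by metis
  define Q where "Q = real CARD('q)"
  have Q: "1 \<le> Q" unfolding Q_def by (simp add: Suc_le_eq)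
  \<comment> \<open>The final 1 makes \<open>C\<close> strictly positive, as \<open>r\<close> and
    \<open>g\<close> are only known to be nonnegative.\<close>
  define C where "C = (r / r1 + 1) * (2 * Q * g) ^ (CARD('m) * CARD('q)) + 1"
  have "0 < C" using r(2) r1(2) g(1) Q by (auto simp: C_def intro!: add_nonneg_pos mult_nonneg_nonneg)
  moreover have "(\<integral>\<^sup>+S. ennreal (exp (- (1/2) * ((norm S)\<^sup>2 + (norm (Y - signal P x S))\<^sup>2))) \<partial>lborel)
      \<le> ennreal (C * (\<Prod>i\<in>UNIV. 1 / (1 + (norm (x $ \<sigma> i))\<^sup>2)) ^ CARD('m))" (is "?I \<le> _")
    for x and Y :: "complex ^ 'n ^ 'm"
  proof -
    define a where "a i = 1 + (norm (x $ \<sigma> i))\<^sup>2" for i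
    define t where "t m i = Y $ m $ \<sigma> i * cnj (x $ \<sigma> i) / of_real (a i)" for m i
    have a: "0 < a i" for i by (auto simp: a_def intro: add_pos_nonneg)
    define f where "f T = (\<Prod>m\<in>UNIV. \<Prod>i\<in>UNIV. ennreal (exp (- (a i / (2 * Q)) * (norm (T $ m $ i - t m i))\<^sup>2)))"
      for T :: "complex ^ 'q ^ 'm"
    have [measurable]: "f \<in> borel_measurable borel" unfolding f_def by measurable
    have "ennreal (exp (- (1/2) * ((norm S)\<^sup>2 + (norm (Y - signal P x S))\<^sup>2))) \<le> f (L S)" for S
    proof -
      \<comment> \<open>Each of the \<open>CARD('q)\<close> coefficients in a row is bounded by the
        norm of that row of \<open>S\<close>, hence the factor \<open>Q\<close> and later the
        precision \<open>a i / (2 * Q)\<close>.\<close>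
      have 1: "(\<Sum>m\<in>UNIV. \<Sum>i\<in>UNIV. (norm (L S $ m $ i))\<^sup>2) \<le> Q * (norm S)\<^sup>2"
      proof -
        have "(norm (L S $ m $ i))\<^sup>2 \<le> (norm (S $ m))\<^sup>2" for m i
          using norm_sum_mult_le[of "S $ m" "P $ \<sigma> i"] P by (intro power_mono) (auto simp: L_nth)
        then have "(\<Sum>m\<in>UNIV. \<Sum>i\<in>UNIV. (norm (L S $ m $ i))\<^sup>2) \<le> (\<Sum>m\<in>UNIV. \<Sum>i\<in>(UNIV :: 'q set). (norm (S $ m))\<^sup>2)"
          by (intro sum_mono)
        also have "\<dots> = Q * (norm S)\<^sup>2"
          by (simp add: Q_def norm_vec_def L2_set_def sum_nonneg sum_distrib_left)
        finally show ?thesis .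
      qed
      have 2: "(\<Sum>m\<in>UNIV. \<Sum>i\<in>UNIV. (norm (Y $ m $ \<sigma> i - L S $ m $ i * x $ \<sigma> i))\<^sup>2) \<le> (norm (Y - signal P x S))\<^sup>2"
      proof -
        have "(\<Sum>i\<in>UNIV. (norm (Y $ m $ \<sigma> i - L S $ m $ i * x $ \<sigma> i))\<^sup>2)
          \<le> (\<Sum>j\<in>UNIV. (norm ((Y - signal P x S) $ m $ j))\<^sup>2)" for m
        proof -
          have "(\<Sum>i\<in>UNIV. (norm (Y $ m $ \<sigma> i - L S $ m $ i * x $ \<sigma> i))\<^sup>2)
            = (\<Sum>j\<in>range \<sigma>. (norm ((Y - signal P x S) $ m $ j))\<^sup>2)"
            using \<open>inj \<sigma>\<close> by (simp add: sum.reindex L_nth signal_nth)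
          also have "\<dots> \<le> (\<Sum>j\<in>UNIV. (norm ((Y - signal P x S) $ m $ j))\<^sup>2)"
            by (intro sum_mono2) auto
          finally show ?thesis .
        qed
        then show ?thesis unfolding norm_matrix_sq by (intro sum_mono)
      qed
      have "(\<Sum>m\<in>UNIV. \<Sum>i\<in>UNIV. a i * (norm (L S $ m $ i - t m i))\<^sup>2)
        \<le> (\<Sum>m\<in>UNIV. \<Sum>i\<in>UNIV. (norm (L S $ m $ i))\<^sup>2 + (norm (Y $ m $ \<sigma> i - L S $ m $ i * x $ \<sigma> i))\<^sup>2)"
        unfolding a_def t_def by (intro sum_mono complete_square_le)
      also have "\<dots> \<le> Q * (norm S)\<^sup>2 + (norm (Y - signal P x S))\<^sup>2"
        using 1 2 by (simp add: sum.distrib)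
      also have "\<dots> \<le> Q * (norm S)\<^sup>2 + Q * (norm (Y - signal P x S))\<^sup>2"
        using Q by (intro add_left_mono) (simp add: mult_le_cancel_right1)
      finally have "(\<Sum>m\<in>UNIV. \<Sum>i\<in>UNIV. a i * (norm (L S $ m $ i - t m i))\<^sup>2) / (2 * Q)
        \<le> (1/2) * ((norm S)\<^sup>2 + (norm (Y - signal P x S))\<^sup>2)"
        using Q by (simp add: divide_le_eq algebra_simps)
      then have "exp (- (1/2) * ((norm S)\<^sup>2 + (norm (Y - signal P x S))\<^sup>2))
        \<le> exp (- ((\<Sum>m\<in>UNIV. \<Sum>i\<in>UNIV. a i * (norm (L S $ m $ i - t m i))\<^sup>2) / (2 * Q)))" by simp
      also have "\<dots> = (\<Prod>m\<in>UNIV. \<Prod>i\<in>UNIV. exp (- (a i / (2 * Q)) * (norm (L S $ m $ i - t m i))\<^sup>2))"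
        by (simp add: exp_sum[symmetric] sum_divide_distrib sum_negf)
      finally show ?thesis
        by (simp add: f_def prod_ennreal prod_nonneg ennreal_leI)
    qed
    then have "?I \<le> (\<integral>\<^sup>+S. f (L S) \<partial>lborel)" by (intro nn_integral_mono)
    then have "?I * ennreal r1 \<le> (\<integral>\<^sup>+S. f (L S) \<partial>lborel) * ennreal r1" by (intro mult_right_mono) auto
    also have "\<dots> = v * (\<integral>\<^sup>+T. f T \<partial>lborel)"
      unfolding v_def r1(1)[symmetric] by (rule nn_integral_lborel_linear[OF lin surj]) measurable
    also have "(\<integral>\<^sup>+T. f T \<partial>lborel) = (\<Prod>m\<in>(UNIV :: 'm set). \<Prod>i\<in>UNIV. ennreal (2 * Q * g * (1 / a i)))"
      unfolding f_def
    proof (subst nn_integral_lborel_matrix)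
      show "(\<Prod>m\<in>UNIV. \<Prod>i\<in>UNIV. \<integral>\<^sup>+z. ennreal (exp (- (a i / (2 * Q)) * (norm (z - t m i))\<^sup>2)) \<partial>lborel)
        = (\<Prod>m\<in>(UNIV :: 'm set). \<Prod>i\<in>UNIV. ennreal (2 * Q * g * (1 / a i)))"
        using a Q by (intro prod.cong refl, subst g(2)) (auto simp: field_simps)
    qed measurable
    also have "\<dots> = ennreal ((\<Prod>i\<in>UNIV. 2 * Q * g * (1 / a i)) ^ CARD('m))"
      using a Q g(1) by (simp add: prod_ennreal prod_nonneg less_imp_le ennreal_power)
    also have "(\<Prod>i\<in>UNIV. 2 * Q * g * (1 / a i)) ^ CARD('m) = (2 * Q * g) ^ (CARD('m) * CARD('q)) * (\<Prod>i\<in>UNIV. 1 / a i) ^ CARD('m)"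
      by (simp only: prod.distrib prod_constant power_mult_distrib power_mult[symmetric] mult.commute)
    finally have le: "?I * ennreal r1 \<le> v * ennreal ((2 * Q * g) ^ (CARD('m) * CARD('q)) * (\<Prod>i\<in>UNIV. 1 / a i) ^ CARD('m))" .
    have "?I = ?I * ennreal r1 * ennreal (1 / r1)"
      using r1(2) by (simp add: mult.assoc ennreal_mult'[symmetric])
    also have "\<dots> \<le> v * ennreal ((2 * Q * g) ^ (CARD('m) * CARD('q)) * (\<Prod>i\<in>UNIV. 1 / a i) ^ CARD('m)) * ennreal (1 / r1)"
      using le by (intro mult_right_mono) auto
    also have "\<dots> = ennreal (r * ((2 * Q * g) ^ (CARD('m) * CARD('q)) * (\<Prod>i\<in>UNIV. 1 / a i) ^ CARD('m)) * (1 / r1))"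
      unfolding r using r(2) r1(2) g(1) Q a
      by (simp add: ennreal_mult'[symmetric] ennreal_mult''[symmetric] prod_nonneg less_imp_le)
    also have "\<dots> \<le> ennreal (C * (\<Prod>i\<in>UNIV. 1 / a i) ^ CARD('m))"
    proof (rule ennreal_leI)
      have "r / r1 * (2 * Q * g) ^ (CARD('m) * CARD('q)) \<le> C"
        using Q g(1) by (simp add: C_def distrib_right)
      then have "r / r1 * (2 * Q * g) ^ (CARD('m) * CARD('q)) * (\<Prod>i\<in>UNIV. 1 / a i) ^ CARD('m) \<le> C * (\<Prod>i\<in>UNIV. 1 / a i) ^ CARD('m)"
        using a by (intro mult_right_mono zero_le_power prod_nonneg) (auto simp: less_imp_le)
      then show "r * ((2 * Q * g) ^ (CARD('m) * CARD('q)) * (\<Prod>i\<in>UNIV. 1 / a i) ^ CARD('m)) * (1 / r1) \<le> C * (\<Prod>i\<in>UNIV. 1 / a i) ^ CARD('m)"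
        by (simp add: ac_simps)
    qed
    finally show ?thesis by (simp add: a_def)
  qed
  ultimately show thesis by (rule that)
qed

text \<open>An entry of \<open>Y\<close> is noise plus signal, and the signal is at most
  \<open>norm S * norm (x $ n)\<close>. This separates the dependence on the input from a quantity
  controlled by the Gaussian exponent.\<close>

lemma one_plus_norm_entry_le:
  fixes P :: "complex ^ 'q ^ 'n" and Y :: "complex ^ 'n ^ 'm"
  assumes P: "\<forall>i. norm (P $ i) = 1"
  shows "1 + (norm (Y $ m $ n))\<^sup>2
    \<le> (1 + (norm (x $ n))\<^sup>2) * (2 * (1 + ((norm S)\<^sup>2 + (norm (Y - signal P x S))\<^sup>2)))"
proof -
  define w where "w = norm (Y - signal P x S)"
  have "norm ((Y - signal P x S) $ m $ n) \<le> w"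
    unfolding w_def by (rule order_trans[OF Finite_Cartesian_Product.norm_nth_le Finite_Cartesian_Product.norm_nth_le])
  moreover have "norm (signal P x S $ m $ n) \<le> norm S * norm (x $ n)"
    using norm_signal_entry_le[of P n x S m] P
    by (meson Finite_Cartesian_Product.norm_nth_le mult_right_mono norm_ge_zero order_trans)
  ultimately have "norm (Y $ m $ n) \<le> w + norm S * norm (x $ n)"
    using norm_triangle_ineq[of "(Y - signal P x S) $ m $ n" "signal P x S $ m $ n"] by simp
  then have "(norm (Y $ m $ n))\<^sup>2 \<le> (w + norm S * norm (x $ n))\<^sup>2" by (intro power_mono) auto
  also have "\<dots> \<le> 2 * w\<^sup>2 + 2 * (norm S)\<^sup>2 * (norm (x $ n))\<^sup>2"
    using zero_le_power2[of "w - norm S * norm (x $ n)"] by (simp add: power2_eq_square algebra_simps)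
  finally have "1 + (norm (Y $ m $ n))\<^sup>2 \<le> 1 + 2 * w\<^sup>2 + 2 * (norm S)\<^sup>2 * (norm (x $ n))\<^sup>2" by simp
  also have "\<dots> \<le> (1 + (norm (x $ n))\<^sup>2) * (2 * (1 + ((norm S)\<^sup>2 + w\<^sup>2)))"
    by (simp add: algebra_simps)
  finally show ?thesis by (simp add: w_def)
qed

text \<open>The gain at a selected index lowers its exponent \<open>e n\<close> from
  \<open>1 + \<epsilon>\<close> to \<open>\<epsilon>\<close>. All exponents stay nonnegative, so
  every base may be enlarged to \<open>1 + (norm x)\<^sup>2\<close> and the exponents
  summed.\<close>

lemma prod_powr_le:
  fixes x :: "complex ^ 'n" and \<sigma> :: "'q::finite \<Rightarrow> 'n"
  assumes "inj \<sigma>" "0 \<le> \<epsilon>"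
  shows "(\<Prod>n\<in>UNIV. (1 + (norm (x $ n))\<^sup>2) powr (1 + \<epsilon>)) * (\<Prod>i\<in>UNIV. 1 / (1 + (norm (x $ \<sigma> i))\<^sup>2))
    \<le> (1 + (norm x)\<^sup>2) powr (real CARD('n) - real CARD('q) + real CARD('n) * \<epsilon>)"
proof -
  define b where "b n = 1 + (norm (x $ n))\<^sup>2" for n
  define e where "e n = 1 + \<epsilon> - of_bool (n \<in> range \<sigma>)" for n
  have b: "1 \<le> b n" "b n \<le> 1 + (norm x)\<^sup>2" for n
    by (auto simp: b_def intro!: power_mono Finite_Cartesian_Product.norm_nth_le)
  have e: "0 \<le> e n" for n using \<open>0 \<le> \<epsilon>\<close> by (simp add: e_def)
  have "(\<Prod>i\<in>UNIV. 1 / b (\<sigma> i)) = (\<Prod>n\<in>range \<sigma>. 1 / b n)"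
    using \<open>inj \<sigma>\<close> by (simp add: prod.reindex)
  also have "\<dots> = (\<Prod>n\<in>UNIV. if n \<in> range \<sigma> then 1 / b n else 1)"
    by (subst prod.If_cases) (auto simp: Int_def)
  also have "\<dots> = (\<Prod>n\<in>UNIV. b n powr - of_bool (n \<in> range \<sigma>))"
    using b(1) by (intro prod.cong refl) (smt (verit) of_bool_eq powr_one powr_minus_divide powr_zero_eq_one minus_zero)
  finally have "(\<Prod>n\<in>UNIV. b n powr (1 + \<epsilon>)) * (\<Prod>i\<in>UNIV. 1 / b (\<sigma> i)) = (\<Prod>n\<in>UNIV. b n powr e n)"
    by (simp add: prod.distrib[symmetric] powr_add[symmetric] e_def)
  also have "\<dots> \<le> (\<Prod>n\<in>(UNIV :: 'n set). (1 + (norm x)\<^sup>2) powr e n)"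
    using b e by (intro prod_mono conjI powr_mono2) (auto intro: order_trans[of _ 1])
  also have "\<dots> = (1 + (norm x)\<^sup>2) powr (\<Sum>n\<in>UNIV. e n)"
    by (rule powr_sum[symmetric]) (auto intro!: add_pos_nonneg less_imp_neq[THEN not_sym])
  also have "(\<Sum>n\<in>UNIV. e n) = real CARD('n) - real CARD('q) + real CARD('n) * \<epsilon>"
    using \<open>inj \<sigma>\<close> by (simp add: e_def sum_subtractf sum.distrib card_image of_bool_def sum.If_cases algebra_simps)
  finally show ?thesis by (simp add: b_def)
qed

text \<open>The Gaussian exponential is split into two halves: one absorbs the polynomial loss from
  inserting the heavy tails, the other is integrated over \<open>S\<close> and yields the gain at
  the selected indices.\<close>

lemma channel_density_le_product:
  fixes P :: "complex ^ 'q ^ 'n"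
  assumes P: "\<forall>i. norm (P $ i) = 1" and rk: "rank P = CARD('q)" and "0 < \<epsilon>"
  obtains q :: "complex ^ 'n ^ 'm \<Rightarrow> ennreal"
  where "q \<in> borel_measurable borel" "(\<integral>\<^sup>+Y. q Y \<partial>lborel) < \<infinity>"
    "\<And>x Y. channel_density P (x, Y) \<le> ennreal ((1 + (norm x)\<^sup>2) powr
       (real CARD('m) * (real CARD('n) - real CARD('q) + real CARD('n) * \<epsilon>))) * q Y"
proof -
  obtain \<sigma> :: "'q \<Rightarrow> 'n" where \<sigma>: "inj \<sigma>" "invertible (\<chi> i. P $ \<sigma> i)"
    using independent_rows_of_full_rank[OF rk] .
  obtain C where C: "0 < C"
    "\<And>x (Y :: complex ^ 'n ^ 'm). (\<integral>\<^sup>+S. ennreal (exp (- (1/2) * ((norm S)\<^sup>2 + (norm (Y - signal P x S))\<^sup>2))) \<partial>lborel)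
      \<le> ennreal (C * (\<Prod>i\<in>UNIV. 1 / (1 + (norm (x $ \<sigma> i))\<^sup>2)) ^ CARD('m))"
    using channel_exp_integral_le[OF P \<sigma>, where ?'m = 'm] by blast
  \<comment> \<open>The total power of \<open>1 + u\<close> collected over all entries of
    \<open>Y\<close>, each contributing \<open>1 + \<epsilon>\<close>.\<close>
  define D where "D = real (CARD('m) * CARD('n)) * (1 + \<epsilon>)"
  have "0 \<le> D" using \<open>0 < \<epsilon>\<close> by (simp add: D_def)
  then obtain C1 where C1: "0 < C1" "\<And>u. 0 \<le> u \<Longrightarrow> exp (- (1/2) * u) \<le> C1 * (1 + u) powr - D"
    using powr_exp_bound[of D "1/2"] by auto
  define h where "h z = (1 + (norm z)\<^sup>2) powr - (1 + \<epsilon>)" for z :: complex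
  define q where "q Y = (\<Prod>m\<in>UNIV. \<Prod>n\<in>UNIV. ennreal (h (Y $ m $ n)))" for Y :: "complex ^ 'n ^ 'm"
  have h0: "0 \<le> h z" for z by (simp add: h_def)
  have [measurable]: "h \<in> borel_measurable borel" unfolding h_def by measurable
  have qm: "q \<in> borel_measurable borel" unfolding q_def by measurable
  have "(\<integral>\<^sup>+z. ennreal (h z) \<partial>lborel) < \<infinity>"
    unfolding h_def using \<open>0 < \<epsilon>\<close> by (intro nn_integral_powr_finite) simp
  then obtain c where "(\<integral>\<^sup>+z. ennreal (h z) \<partial>lborel) = ennreal c" "0 \<le> c"
    by (cases "\<integral>\<^sup>+z. ennreal (h z) \<partial>lborel") auto
  then have qfin: "(\<integral>\<^sup>+Y. q Y \<partial>lborel) < \<infinity>"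
    unfolding q_def by (subst nn_integral_lborel_matrix) (auto simp: ennreal_power)
  show thesis
  proof (rule that[of "\<lambda>Y. ennreal (C1 * 2 powr D * C) * q Y"])
    show "(\<lambda>Y. ennreal (C1 * 2 powr D * C) * q Y) \<in> borel_measurable borel" using qm by measurable
    show "(\<integral>\<^sup>+Y. ennreal (C1 * 2 powr D * C) * q Y \<partial>lborel) < \<infinity>"
      using qm qfin by (simp add: nn_integral_cmult ennreal_mult_less_top)
    fix x :: "complex ^ 'n" and Y :: "complex ^ 'n ^ 'm"
    define H where "H = (\<Prod>m\<in>(UNIV :: 'm set). \<Prod>n\<in>UNIV. h (Y $ m $ n))"
    define X where "X = (\<Prod>n\<in>UNIV. (1 + (norm (x $ n))\<^sup>2) powr (1 + \<epsilon>))"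
    define I where "I = (\<Prod>i\<in>UNIV. 1 / (1 + (norm (x $ \<sigma> i))\<^sup>2))"
    have H0: "0 \<le> H" unfolding H_def by (intro prod_nonneg h0)
    have X0: "0 \<le> X" unfolding X_def by (intro prod_nonneg) simp
    have I0: "0 \<le> I" unfolding I_def by (intro prod_nonneg) simp
    have qH: "q Y = ennreal H" by (simp add: q_def H_def prod_ennreal h0 prod_nonneg)
    have pt: "ennreal (exp (- ((norm S)\<^sup>2 + (norm (Y - signal P x S))\<^sup>2)))
      \<le> ennreal (C1 * 2 powr D * (X ^ CARD('m)) * H) * ennreal (exp (- (1/2) * ((norm S)\<^sup>2 + (norm (Y - signal P x S))\<^sup>2)))" for S
    proof -
      define u where "u = (norm S)\<^sup>2 + (norm (Y - signal P x S))\<^sup>2"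
      have u: "0 \<le> u" by (simp add: u_def)
      have "(2 * (1 + u)) powr - D = (\<Prod>m\<in>(UNIV :: 'm set). \<Prod>n\<in>(UNIV :: 'n set). (2 * (1 + u)) powr - (1 + \<epsilon>))"
        using u by (simp add: D_def powr_realpow[symmetric] powr_powr powr_power algebra_simps)
      also have "\<dots> \<le> (\<Prod>m\<in>UNIV. \<Prod>n\<in>UNIV. (1 + (norm (x $ n))\<^sup>2) powr (1 + \<epsilon>) * h (Y $ m $ n))"
      proof (intro prod_mono conjI prod_nonneg)
        fix m :: 'm and n :: 'n
        define b where "b = 1 + (norm (x $ n))\<^sup>2"
        have b: "0 < b" by (auto simp: b_def intro: add_pos_nonneg)
        have "1 + (norm (Y $ m $ n))\<^sup>2 \<le> b * (2 * (1 + u))"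
          unfolding b_def u_def by (rule one_plus_norm_entry_le[OF P])
        then have "(b * (2 * (1 + u))) powr - (1 + \<epsilon>) \<le> h (Y $ m $ n)"
          unfolding h_def using \<open>0 < \<epsilon>\<close> by (intro powr_mono2') (auto intro: add_pos_nonneg)
        then have "b powr (1 + \<epsilon>) * (b * (2 * (1 + u))) powr - (1 + \<epsilon>) \<le> b powr (1 + \<epsilon>) * h (Y $ m $ n)"
          by (intro mult_left_mono) auto
        moreover have "(b * (2 * (1 + u))) powr - (1 + \<epsilon>) = b powr - (1 + \<epsilon>) * (2 * (1 + u)) powr - (1 + \<epsilon>)"
          by (rule powr_mult)
        moreover have "b powr (1 + \<epsilon>) * b powr - (1 + \<epsilon>) = 1"
          using b by (simp add: powr_add[symmetric])
        ultimately show "(2 * (1 + u)) powr - (1 + \<epsilon>) \<le> (1 + (norm (x $ n))\<^sup>2) powr (1 + \<epsilon>) * h (Y $ m $ n)"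
          by (simp add: mult.assoc[symmetric] b_def[symmetric])
      qed (auto intro!: mult_nonneg_nonneg h0)
      also have "\<dots> = X ^ CARD('m) * H"
        by (simp add: X_def H_def prod.distrib)
      finally have D_le: "(2 * (1 + u)) powr - D \<le> X ^ CARD('m) * H" .
      have "exp (- u) = exp (- (1/2) * u) * exp (- (1/2) * u)" by (simp add: exp_add[symmetric])
      also have "\<dots> \<le> (C1 * (1 + u) powr - D) * exp (- (1/2) * u)"
        using C1(2)[OF u] by (intro mult_right_mono) auto
      also have "(1 + u) powr - D = 2 powr D * (2 * (1 + u)) powr - D"
        using u by (subst powr_mult) (auto simp: powr_minus)
      also have "C1 * (2 powr D * (2 * (1 + u)) powr - D) * exp (- (1/2) * u) \<le> C1 * (2 powr D * (X ^ CARD('m) * H)) * exp (- (1/2) * u)"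
        using D_le C1(1) by (intro mult_right_mono mult_left_mono) auto
      finally show ?thesis
        unfolding u_def[symmetric] by (subst ennreal_mult''[symmetric]) (auto intro: ennreal_leI simp: ac_simps)
    qed
    have "channel_density P (x, Y) \<le> (\<integral>\<^sup>+S. ennreal (exp (- ((norm S)\<^sup>2 + (norm (Y - signal P x S))\<^sup>2))) \<partial>lborel)"
      by (rule channel_density_le_exp)
    also have "\<dots> \<le> (\<integral>\<^sup>+S. ennreal (C1 * 2 powr D * (X ^ CARD('m)) * H) * ennreal (exp (- (1/2) * ((norm S)\<^sup>2 + (norm (Y - signal P x S))\<^sup>2))) \<partial>lborel)"
      by (intro nn_integral_mono pt)
    also have "\<dots> = ennreal (C1 * 2 powr D * (X ^ CARD('m)) * H) * (\<integral>\<^sup>+S. ennreal (exp (- (1/2) * ((norm S)\<^sup>2 + (norm (Y - signal P x S))\<^sup>2))) \<partial>lborel)"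
      by (rule nn_integral_cmult) measurable
    also have "\<dots> \<le> ennreal (C1 * 2 powr D * (X ^ CARD('m)) * H) * ennreal (C * I ^ CARD('m))"
      using C(2)[where Y=Y and x=x] unfolding I_def by (intro mult_left_mono) auto
    also have "\<dots> = ennreal ((X * I) ^ CARD('m) * (C1 * 2 powr D * C * H))"
      using C(1) C1(1) I0 X0 H0 by (subst ennreal_mult''[symmetric]) (simp_all add: power_mult_distrib ac_simps)
    also have "\<dots> \<le> ennreal (((1 + (norm x)\<^sup>2) powr (real CARD('n) - real CARD('q) + real CARD('n) * \<epsilon>)) ^ CARD('m) * (C1 * 2 powr D * C * H))"
      using prod_powr_le[OF \<sigma>(1), of \<epsilon> x] \<open>0 < \<epsilon>\<close> C(1) C1(1) I0 X0 H0 unfolding X_def[symmetric] I_def[symmetric]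
      by (intro ennreal_leI mult_right_mono power_mono) auto
    also have "\<dots> = ennreal ((1 + (norm x)\<^sup>2) powr (real CARD('m) * (real CARD('n) - real CARD('q) + real CARD('n) * \<epsilon>))) * (ennreal (C1 * 2 powr D * C) * q Y)"
    proof -
      have "((1 + (norm x)\<^sup>2) powr e) ^ CARD('m) = (1 + (norm x)\<^sup>2) powr (real CARD('m) * e)" for e
        using add_pos_nonneg[of 1 "(norm x)\<^sup>2"] by (subst powr_power) (auto simp: mult.commute)
      then show ?thesis
        unfolding qH using C(1) C1(1) H0 by (simp add: ennreal_mult'[symmetric])
    qed
    finally show "channel_density P (x, Y) \<le> ennreal ((1 + (norm x)\<^sup>2) powr
       (real CARD('m) * (real CARD('n) - real CARD('q) + real CARD('n) * \<epsilon>))) * (ennreal (C1 * 2 powr D * C) * q Y)" .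
  qed
qed

section \<open>The pre-log\<close>

text \<open>After division by \<open>ln rho\<close> the constant \<open>ln C\<close> vanishes and
  \<open>ln (1 + n * rho)\<close> counts as 1, so only the exponent \<open>B\<close>
  survives.\<close>

lemma prelog_le:
  fixes P :: "complex ^ 'q ^ 'n" and q :: "complex ^ 'n ^ 'm \<Rightarrow> ennreal"
  assumes "0 \<le> B" and q: "q \<in> borel_measurable borel" "(\<integral>\<^sup>+Y. q Y \<partial>lborel) < \<infinity>"
    and le: "\<And>x Y. channel_density P (x, Y) \<le> ennreal ((1 + (norm x)\<^sup>2) powr B) * q Y"
  shows "Limsup at_top (\<lambda>rho. capacity P TYPE('m) rho / ereal (ln rho)) \<le> ereal (B / real CARD('n))"
proof -
  define n where "n = real CARD('n)"
  have n: "0 < n" by (simp add: n_def)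
  obtain C0 where C0: "(\<integral>\<^sup>+Y. q Y \<partial>lborel) = ennreal C0"
    using q(2) by (cases "\<integral>\<^sup>+Y. q Y \<partial>lborel") auto
  \<comment> \<open>The duality bound requires \<open>ln C\<close> to be nonnegative.\<close>
  define C where "C = max 1 C0"
  have C: "1 \<le> C" "(\<integral>\<^sup>+Y. q Y \<partial>lborel) \<le> ennreal C"
    by (auto simp: C_def C0 intro: ennreal_leI)
  define g where "g rho = (ln C + B * (ln (1 + n * rho) + 1)) / n / ln rho" for rho
  have "capacity P TYPE('m) rho / ereal (ln rho) \<le> ereal (g rho)" if rho: "1 < rho" for rho
  proof -
    have "mi_xY P mu TYPE('m) \<le> ln C + B * (ln (1 + n * rho) + 1)"
      if "admissible_input rho mu" for mu :: "(complex ^ 'n) measure"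
      using mi_xY_le[OF that _ \<open>0 \<le> B\<close> C(1) q(1) C(2) le] rho by (simp add: n_def)
    then have "(SUP mu \<in> {mu :: (complex ^ 'n) measure. admissible_input rho mu}. ereal (mi_xY P mu TYPE('m)))
        \<le> ereal (ln C + B * (ln (1 + n * rho) + 1))"
      by (intro SUP_least) auto
    then have "capacity P TYPE('m) rho \<le> ereal (ln C + B * (ln (1 + n * rho) + 1)) / ereal n"
      unfolding capacity_def n_def by (rule ereal_divide_right_mono) simp
    then have "capacity P TYPE('m) rho / ereal (ln rho) \<le> ereal (ln C + B * (ln (1 + n * rho) + 1)) / ereal n / ereal (ln rho)"
      using rho by (intro ereal_divide_right_mono) auto
    then show ?thesis using n rho by (simp add: g_def)
  qed
  then have "Limsup at_top (\<lambda>rho. capacity P TYPE('m) rho / ereal (ln rho)) \<le> Limsup at_top (\<lambda>rho. ereal (g rho))"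
    by (intro Limsup_mono) (auto intro: eventually_mono[OF eventually_gt_at_top[of 1]])
  also have "\<dots> = ereal (B / n)"
  proof (rule lim_imp_Limsup)
    have "(g \<longlongrightarrow> B * inverse n) at_top" unfolding g_def using n by real_asymp
    then have "(g \<longlongrightarrow> B / n) at_top" by (simp add: divide_inverse)
    then show "((\<lambda>rho. ereal (g rho)) \<longlongrightarrow> ereal (B / n)) at_top" by simp
  qed simp
  finally show ?thesis by (simp add: n_def)
qed

theorem theorem2:
  fixes P :: "complex ^ 'q ^ 'n"
  assumes "CARD('q) \<le> CARD('n)"
    and "rank P = CARD('q)"
    and "\<forall>i. norm (P $ i) = 1"
  shows "Limsup at_top (\<lambda>rho. capacity P TYPE('m::finite) rho / ereal (ln rho))
           \<le> ereal (min (real CARD('m) * (1 - real CARD('q) / real CARD('n)))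
                        (1 - 1 / real CARD('n)))"
    (is "?L \<le> ereal (min ?a ?b)")
proof -
  let ?M = "real CARD('m)" and ?N = "real CARD('n)" and ?Q = "real CARD('q)"
  have "?L \<le> ereal ?a"
  proof (rule ereal_le_epsilon2)
    fix e :: real assume "0 < e"
    \<comment> \<open>With this choice the excess exponent is \<open>?N * e\<close>, so the pre-log
      exceeds \<open>?a\<close> by exactly \<open>e\<close>.\<close>
    then have e: "0 < e / ?M" by simp
    obtain q :: "complex ^ 'n ^ 'm \<Rightarrow> ennreal"
      where q: "q \<in> borel_measurable borel" "(\<integral>\<^sup>+Y. q Y \<partial>lborel) < \<infinity>"
        "\<And>x Y. channel_density P (x, Y) \<le> ennreal ((1 + (norm x)\<^sup>2) powr (?M * (?N - ?Q + ?N * (e / ?M)))) * q Y"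
      using channel_density_le_product[OF assms(3,2) e, where ?'m='m] by blast
    have "?L \<le> ereal (?M * (?N - ?Q + ?N * (e / ?M)) / ?N)"
      using assms(1) e by (intro prelog_le[OF _ q] mult_nonneg_nonneg add_nonneg_nonneg) auto
    also have "?M * (?N - ?Q + ?N * (e / ?M)) / ?N = ?a + e"
      by (simp add: field_simps)
    finally show "?L \<le> ereal ?a + ereal e" by simp
  qed
  moreover have "?L \<le> ereal ?b"
  proof (rule ereal_le_epsilon2)
    fix e :: real assume "0 < e"
    \<comment> \<open>The factor \<open>?N\<close> cancels in the pre-log and leaves the excess
      \<open>e\<close>.\<close>
    then have e: "0 < e * ?N" by simp
    obtain q :: "complex ^ 'n ^ 'm \<Rightarrow> ennreal"
      where q: "q \<in> borel_measurable borel" "(\<integral>\<^sup>+Y. q Y \<partial>lborel) < \<infinity>"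
        "\<And>x Y. channel_density P (x, Y) \<le> ennreal ((1 + (norm x)\<^sup>2) powr (?N - 1 + e * ?N)) * q Y"
      using channel_density_le_mixture[OF assms(3) e, where ?'m='m] by blast
    have "1 \<le> ?N" by (simp add: Suc_le_eq)
    then have "?L \<le> ereal ((?N - 1 + e * ?N) / ?N)"
      using e by (intro prelog_le[OF _ q]) linarith
    also have "(?N - 1 + e * ?N) / ?N = ?b + e"
      by (simp add: field_simps)
    finally show "?L \<le> ereal ?b + ereal e" by simp
  qed
  ultimately show ?thesis by (simp add: min_def)
qed

end
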